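(* Let $\mathcal{B}$ be a uniform body whose material groupoid $\Omega(\mathcal{B})$ is a Lie subgroupoid of $\Pi^1(\mathcal{B},\mathcal{B})$. If $\mathcal{B}$ is homogeneous, then the material algebroid $A\Omega(\mathcal{B})$ is integrable by a Lie subgroup $G$ of $Gl(n,\mathbb{R})$ (where $n=\dim\mathcal{B}=3$). Conversely, if $A\Omega(\mathcal{B})$ is integrable by $G$, for a Lie subgroup $G$ of $Gl(n,\mathbb{R})$, then $\mathcal{B}$ is locally homogeneous.
   Context: 1-jets groupoid: for a manifold $M$, $\Pi^1(M,M)$ is the set of 1-jets $j^1_{x,y}\phi$ of local diffeomorphisms $\phi$ of $M$ with $\phi(x)=y$; it is a Lie groupoid over $M$ with source $\alpha(j^1_{x,y}\phi)=x$, target $\beta(j^1_{x,y}\phi)=y$, identities $\epsilon(x)=j^1_{x,x}\mathrm{Id}$ and composition of jets. Local coordinates $(x^i)$ on $U$ and $(y^j)$ on $V$ induce coordinates $(x^i,y^j,y^j_i)$ on $(\alpha,\beta)^{-1}(U\times V)$, with $y^j_i(j^1_{x,y}\psi)=\partial(y^j\circ\psi)/\partial x^i|_x$. Body: a three-dimensional manifold $\mathcal{B}$ which can be covered by one chart, identified with an open subset of $\mathbb{R}^3$ by a fixed embedding (reference configuration). A deformation is an embedding $\kappa:\mathcal{B}\to\mathbb{R}^3$; an infinitesimal deformation at $Y$ is its 1-jet $j^1_{Y,\kappa(Y)}\kappa$. The body is equipped with a response functional: a differentiable map $W:\Pi^1(\mathcal{B},\mathcal{B})\to V$, $V$ a real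 vector space, such that $W(j^1_{X,Y}\phi)=W(j^1_{X,Z}(\tau_{Z-Y}\circ\phi))$ for all $X,Y,Z\in\mathcal{B}$ and all $j^1_{X,Y}\phi$, where $\tau_v$ is translation of $\mathbb{R}^3$ by $v$. By this invariance $W$ extends to 1-jets of local diffeomorphisms from points of $\mathcal{B}$ to points of $\mathbb{R}^3$. Material isomorphism: a jet $j^1_{X,Y}\psi\in\Pi^1(\mathcal{B},\mathcal{B})$ with $W(j^1_{Y,\kappa(Y)}\kappa\cdot j^1_{X,Y}\psi)=W(j^1_{Y,\kappa(Y)}\kappa)$ for every infinitesimal deformation $j^1_{Y,\kappa(Y)}\kappa$ at $Y$. $\Omega(\mathcal{B})\subseteq\Pi^1(\mathcal{B},\mathcal{B})$ is the subgroupoid (over $\mathcal{B}$) of all material isomorphisms. $\mathcal{B}$ is uniform if for all $X,Y\in\mathcal{B}$ there is a material isomorphism from $X$ to $Y$. Standing assumption: $\Omega(\mathcal{B})$ is a Lie subgroupoid of $\Pi^1(\mathcal{B},\mathcal{B})$; it is called the material groupoid. Homogeneity: $\mathcal{B}$ is homogeneous if there is a (global) deformation $\kappa$ such that for all $X,Y\in\mathcal{B}$ the jet $P(X,Y)=j^1_{X,Y}(\kappa^{-1}\circ\tau_{\kappa(Y)-\kappa(X)}\circ\kappa)$ belongs to $\Omega(\mathcal{B})$. $\mathcal{B}$ is locally homogeneous if it is covered by open subsets which are homogeneous (as bodies, with the restricted response functional). Lie algebroid of a Lie groupoid $\Gamma\rightrightarrows M$: the vector bundle $A\Gamma\to M$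 with fibre $\ker T_{\epsilon(x)}\beta$ at $x$, with anchor $\sharp=T\alpha|_{A\Gamma}:A\Gamma\to TM$ and with the bracket of sections induced by identifying sections with left-invariant vector fields on $\Gamma$. The material algebroid is $A\Omega(\mathcal{B})\subseteq A\Pi^1(\mathcal{B},\mathcal{B})$. A local coordinate system $(x^i)$ on $U$ induces coordinates $(x^i,v^i,v^j_i)$ on $A\Pi^1(U,U)$, the triple representing $v^i\frac{\partial}{\partial x^i}+v^j_i\frac{\partial}{\partial y^j_i}$ at $\epsilon(x)$. Integrability of a subalgebroid: let $G$ be a Lie subgroup of $Gl(n,\mathbb{R})$ with Lie algebra $\mathfrak{g}$ and let $M$ have dimension $n$. A Lie subalgebroid $A'$ of $A\Pi^1(M,M)$ (over $M$) is integrable by $G$ if it is locally isomorphic, via coordinates induced from the base, to the trivial algebroid $T\mathbb{R}^n\oplus(\mathbb{R}^n\times\mathfrak{g})$; that is, $M$ is covered by charts $(U,(x^i))$ in whose induced coordinates $A'|_U=\{(x^i,v^i,v^j_i):(v^j_i)\in\mathfrak{g}\}$. *)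

theory Defs
  imports "HOL-Analysis.Analysis"
begin

section \<open>Smooth maps and submanifolds of Euclidean spaces\<close>

text \<open>The two notions below are only ever applied to open sets \<open>S\<close>, where \<open>smooth_on S f\<close> says that
  \<open>f\<close> is of class \<open>C\<close>-infinity: all iterated directional derivatives exist and are continuous.\<close>

primrec Ck_on ::
  "nat \<Rightarrow> 'a::euclidean_space set \<Rightarrow> ('a \<Rightarrow> 'b::real_normed_vector) \<Rightarrow> bool" where
  "Ck_on 0 S f \<longleftrightarrow> continuous_on S f"
| "Ck_on (Suc k) S f \<longleftrightarrow>
     (\<forall>x\<in>S. f differentiable (at x)) \<and> (\<forall>v. Ck_on k S (\<lambda>x. frechet_derivative f (at x) v))"

definition smooth_on :: "'a::euclidean_space set \<Rightarrow> ('a \<Rightarrow> 'b::real_normed_vector) \<Rightarrow> bool" where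
  "smooth_on S f \<longleftrightarrow> (\<forall>k. Ck_on k S f)"

definition diffeomorphism ::
  "'a::euclidean_space set \<Rightarrow> 'b::euclidean_space set \<Rightarrow> ('a \<Rightarrow> 'b) \<Rightarrow> bool" where
  "diffeomorphism U V f \<longleftrightarrow> open U \<and> open V \<and> bij_betw f U V \<and>
     smooth_on U f \<and> smooth_on V (inv_into U f)"

definition embedded_submanifold :: "nat \<Rightarrow> 'a::euclidean_space set \<Rightarrow> bool" where
  "embedded_submanifold k S \<longleftrightarrow>
     (\<forall>p\<in>S. \<exists>U V (\<Phi>::'a \<Rightarrow> 'a) L. p \<in> U \<and> diffeomorphism U V \<Phi> \<and>
        subspace L \<and> dim L = k \<and> \<Phi> ` (U \<inter> S) = V \<inter> L)"

text \<open>An immersed submanifold is presented by its own manifold topology \<open>T\<close>, the underlying set being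
  \<open>topspace T\<close>. An injective immersion is locally an embedding, so the smooth structure is determined
  by \<open>T\<close>. The topology \<open>T\<close> is automatically finer than the topology induced from the ambient space, hence
  Hausdorff. Embedded submanifolds \<open>S\<close> are the case \<open>T = top_of_set S\<close>.\<close>

definition immersed_submanifold :: "nat \<Rightarrow> 'a::euclidean_space topology \<Rightarrow> bool" where
  "immersed_submanifold k T \<longleftrightarrow> second_countable T \<and>
     (\<forall>p\<in>topspace T. \<exists>P. openin T P \<and> p \<in> P \<and>
        embedded_submanifold k P \<and> subtopology T P = top_of_set P)"

text \<open>Smooth maps between immersed submanifolds: locally the restriction of a smooth map of the ambient
  spaces, and continuous for the manifold topologies (continuity into \<open>T'\<close> is what
  makes a smooth map into the ambient space smooth into an immersed submanifold).\<close>

definition smooth_map ::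
  "'a::euclidean_space topology \<Rightarrow> 'b::euclidean_space topology \<Rightarrow> ('a \<Rightarrow> 'b) \<Rightarrow> bool" where
  "smooth_map T T' f \<longleftrightarrow> continuous_map T T' f \<and>
     (\<forall>p\<in>topspace T. \<exists>P U g. openin T P \<and> p \<in> P \<and> P \<subseteq> U \<and> open U \<and> smooth_on U g \<and>
        (\<forall>x\<in>P. f x = g x))"

text \<open>Tangent spaces consist of the velocities of smooth curves in the submanifold.\<close>

definition tangent_space :: "'a::euclidean_space topology \<Rightarrow> 'a \<Rightarrow> 'a set" where
  "tangent_space T p = {w. \<exists>e>0. \<exists>\<gamma>::real \<Rightarrow> 'a.
     smooth_map (top_of_set {-e<..<e}) T \<gamma> \<and> \<gamma> 0 = p \<and> (\<gamma> has_vector_derivative w) (at 0)}"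

text \<open>Here \<open>f\<close> is defined and smooth on a neighbourhood of \<open>topspace T\<close>, and its codomain is an open subset
  of the Euclidean space \<open>'b\<close>, whose tangent spaces are all of \<open>'b\<close>.\<close>

definition submersive ::
  "'a::euclidean_space topology \<Rightarrow> ('a \<Rightarrow> 'b::euclidean_space) \<Rightarrow> bool" where
  "submersive T f \<longleftrightarrow>
     (\<forall>p\<in>topspace T. frechet_derivative f (at p) ` tangent_space T p = UNIV)"


section \<open>The groupoid of 1-jets\<close>

text \<open>The jet of \<open>\<phi>\<close> from \<open>x\<close> to \<open>y = \<phi> x\<close> is the triple \<open>(x, y, F)\<close>, with \<open>F\<close> the Jacobian matrix of \<open>\<phi>\<close> at
  \<open>x\<close>, \<open>F $ j $ i\<close> being the derivative of the \<open>j\<close>-th component in direction \<open>i\<close>. For open \<open>M\<close> this makes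
  \<open>Pi1 M M\<close> an open subset of a Euclidean space, which is its manifold structure.\<close>

type_synonym 'n jet = "(real, 'n) vec \<times> (real, 'n) vec \<times> ((real, 'n) vec, 'n) vec"

definition jet1 :: "(real^'n \<Rightarrow> real^'n) \<Rightarrow> real^'n \<Rightarrow> ('n::finite) jet" where
  "jet1 \<phi> x = (x, \<phi> x, matrix (frechet_derivative \<phi> (at x)))"

definition jsrc :: "('n::finite) jet \<Rightarrow> real^'n" where
  "jsrc j = fst j"

definition jtgt :: "('n::finite) jet \<Rightarrow> real^'n" where
  "jtgt j = fst (snd j)"

definition jlin :: "('n::finite) jet \<Rightarrow> real^'n^'n" where
  "jlin j = snd (snd j)"

definition jid :: "real^'n \<Rightarrow> ('n::finite) jet" where
  "jid x = jet1 id x"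

definition jcomp :: "('n::finite) jet \<Rightarrow> 'n jet \<Rightarrow> 'n jet" (infixl "\<odot>" 70) where
  "h \<odot> j = (jsrc j, jtgt h, jlin h ** jlin j)"

definition jinv :: "('n::finite) jet \<Rightarrow> 'n jet" where
  "jinv j = (jtgt j, jsrc j, matrix_inv (jlin j))"

definition local_diffeo_at ::
  "(real^'n) set \<Rightarrow> (real^'n) set \<Rightarrow> (real^'n \<Rightarrow> real^'n) \<Rightarrow> real^'n \<Rightarrow> bool" where
  "local_diffeo_at M N \<phi> x \<longleftrightarrow> (\<exists>U V. x \<in> U \<and> U \<subseteq> M \<and> V \<subseteq> N \<and> diffeomorphism U V \<phi>)"

definition Pi1 :: "(real^'n) set \<Rightarrow> (real^'n) set \<Rightarrow> ('n::finite) jet set" where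
  "Pi1 M N = {jet1 \<phi> x |\<phi> x. local_diffeo_at M N \<phi> x}"

text \<open>Lie subgroupoids of \<open>Pi1 M M\<close> over the whole base \<open>M\<close>, as immersed submanifolds. The domain of the
  composition is the fibre product of source and target.\<close>

definition lie_subgroupoid :: "(real^'n) set \<Rightarrow> ('n::finite) jet topology \<Rightarrow> bool" where
  "lie_subgroupoid M T \<longleftrightarrow>
     topspace T \<subseteq> Pi1 M M \<and>
     (\<forall>x\<in>M. jid x \<in> topspace T) \<and>
     (\<forall>j\<in>topspace T. jinv j \<in> topspace T) \<and>
     (\<forall>h\<in>topspace T. \<forall>j\<in>topspace T. jsrc h = jtgt j \<longrightarrow> h \<odot> j \<in> topspace T) \<and>
     (\<exists>k. immersed_submanifold k T) \<and>
     smooth_map T (top_of_set M) jsrc \<and> submersive T jsrc \<and>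
     smooth_map T (top_of_set M) jtgt \<and> submersive T jtgt \<and>
     smooth_map (top_of_set M) T jid \<and>
     smooth_map T T jinv \<and>
     smooth_map (subtopology (prod_topology T T) {(h, j). jsrc h = jtgt j}) T (\<lambda>(h, j). h \<odot> j)"

text \<open>The total space of the Lie algebroid of a Lie subgroupoid \<open>T\<close> over \<open>M\<close>: the fibre at \<open>x\<close> is the
  kernel of the derivative of the target map on the tangent space at \<open>jid x\<close>.\<close>

definition lie_algebroid ::
  "(real^'n) set \<Rightarrow> ('n::finite) jet topology \<Rightarrow> ((real^'n) \<times> 'n jet) set" where
  "lie_algebroid M T = {(x, w). x \<in> M \<and> w \<in> tangent_space T (jid x) \<and>
     frechet_derivative jtgt (at (jid x)) w = 0}"


section \<open>Integrability of subalgebroids\<close>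

text \<open>Lie subgroups of the general linear group, again with their own manifold topology.\<close>

definition lie_subgroup_GL :: "(real^'n^'n) topology \<Rightarrow> bool" where
  "lie_subgroup_GL G \<longleftrightarrow>
     (\<forall>A\<in>topspace G. invertible A) \<and>
     mat 1 \<in> topspace G \<and>
     (\<forall>A\<in>topspace G. matrix_inv A \<in> topspace G) \<and>
     (\<forall>A\<in>topspace G. \<forall>C\<in>topspace G. A ** C \<in> topspace G) \<and>
     (\<exists>k. immersed_submanifold k G) \<and>
     smooth_map G G matrix_inv \<and>
     smooth_map (prod_topology G G) G (\<lambda>(A, C). A ** C)"

definition lie_algebra_of :: "(real^'n^'n) topology \<Rightarrow> (real^'n^'n) set" where
  "lie_algebra_of G = tangent_space G (mat 1)"

definition chart_on :: "(real^'n) set \<Rightarrow> (real^'n) set \<Rightarrow> (real^'n \<Rightarrow> real^'n) \<Rightarrow> bool" where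
  "chart_on M U \<phi> \<longleftrightarrow> U \<subseteq> M \<and> diffeomorphism U (\<phi> ` U) \<phi>"

text \<open>For the jet of \<open>\<psi>\<close> from \<open>x\<close> to \<open>y\<close>, both in the domain of the chart \<open>\<phi>\<close>, the induced coordinates are
  \<open>\<phi> x\<close>, \<open>\<phi> y\<close> and the Jacobian matrix at \<open>\<phi> x\<close> of \<open>\<psi>\<close> read in the chart; that is, they form the jet
  from \<open>\<phi> x\<close> to \<open>\<phi> y\<close> of the conjugate of \<open>\<psi>\<close> by \<open>\<phi>\<close>.\<close>

definition jet_coords :: "(real^'n \<Rightarrow> real^'n) \<Rightarrow> ('n::finite) jet \<Rightarrow> 'n jet" where
  "jet_coords \<phi> j = jet1 \<phi> (jtgt j) \<odot> j \<odot> jinv (jet1 \<phi> (jsrc j))"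

text \<open>The coordinates \<open>(x\<^sup>i, v\<^sup>i, v\<^sup>j\<^sub>i)\<close> of an element \<open>(x, w)\<close> of the 1-jets algebroid: the components of
  the tangent vector \<open>w\<close> at \<open>jid x\<close> with respect to the coordinates \<open>jet_coords \<phi>\<close>. The component along
  the target coordinates vanishes on the algebroid and is dropped.\<close>

definition algebroid_coords ::
  "(real^'n \<Rightarrow> real^'n) \<Rightarrow> (real^'n) \<times> ('n::finite) jet \<Rightarrow> (real^'n) \<times> (real^'n) \<times> (real^'n^'n)" where
  "algebroid_coords \<phi> = (\<lambda>(x, w).
     let dw = frechet_derivative (jet_coords \<phi>) (at (jid x)) w
     in (\<phi> x, jsrc dw, jlin dw))"

definition integrable_by ::
  "(real^'n) set \<Rightarrow> ((real^'n) \<times> ('n::finite) jet) set \<Rightarrow> (real^'n^'n) topology \<Rightarrow> bool" where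
  "integrable_by M A G \<longleftrightarrow>
     (\<forall>x\<in>M. \<exists>U \<phi>. x \<in> U \<and> chart_on M U \<phi> \<and>
        algebroid_coords \<phi> ` {a \<in> A. fst a \<in> U} = \<phi> ` U \<times> UNIV \<times> lie_algebra_of G)"


section \<open>Bodies\<close>

abbreviation translate :: "real^'n \<Rightarrow> real^'n \<Rightarrow> real^'n" where
  "translate v \<equiv> \<lambda>z. z + v"

definition body :: "(real^3) set \<Rightarrow> (3 jet \<Rightarrow> 'v::real_normed_vector) \<Rightarrow> bool" where
  "body B W \<longleftrightarrow> open B \<and> W differentiable_on Pi1 B B \<and>
     (\<forall>X\<in>B. \<forall>Y\<in>B. \<forall>Z\<in>B. \<forall>\<phi>. local_diffeo_at B B \<phi> X \<and> \<phi> X = Y \<longrightarrow>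
        W (jet1 \<phi> X) = W (jet1 (translate (Z - Y) \<circ> \<phi>) X))"

text \<open>The extension of \<open>W\<close> to jets from points of the body to arbitrary points of space: the target is
  first translated into the body, here to the source (by translation invariance any other point of
  the body gives the same value).\<close>

definition response_ext :: "(3 jet \<Rightarrow> 'v::real_normed_vector) \<Rightarrow> 3 jet \<Rightarrow> 'v" where
  "response_ext W j = W (jet1 (translate (jsrc j - jtgt j)) (jtgt j) \<odot> j)"

definition deformation :: "(real^3) set \<Rightarrow> (real^3 \<Rightarrow> real^3) \<Rightarrow> bool" where
  "deformation B \<kappa> \<longleftrightarrow> smooth_on B \<kappa> \<and>
     (\<forall>X\<in>B. inj (frechet_derivative \<kappa> (at X))) \<and>
     (\<exists>g. homeomorphism B (\<kappa> ` B) \<kappa> g)"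

definition material_groupoid ::
  "(real^3) set \<Rightarrow> (3 jet \<Rightarrow> 'v::real_normed_vector) \<Rightarrow> 3 jet set" where
  "material_groupoid B W = {j \<in> Pi1 B B. \<forall>\<kappa>. deformation B \<kappa> \<longrightarrow>
     response_ext W (jet1 \<kappa> (jtgt j) \<odot> j) = response_ext W (jet1 \<kappa> (jtgt j))}"

definition uniform_body :: "(real^3) set \<Rightarrow> (3 jet \<Rightarrow> 'v::real_normed_vector) \<Rightarrow> bool" where
  "uniform_body B W \<longleftrightarrow>
     (\<forall>X\<in>B. \<forall>Y\<in>B. \<exists>j\<in>material_groupoid B W. jsrc j = X \<and> jtgt j = Y)"

definition homogeneous :: "(real^3) set \<Rightarrow> (3 jet \<Rightarrow> 'v::real_normed_vector) \<Rightarrow> bool" where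
  "homogeneous B W \<longleftrightarrow> (\<exists>\<kappa>. deformation B \<kappa> \<and>
     (\<forall>X\<in>B. \<forall>Y\<in>B.
        jet1 (inv_into B \<kappa> \<circ> translate (\<kappa> Y - \<kappa> X) \<circ> \<kappa>) X \<in> material_groupoid B W))"

text \<open>\<open>homogeneous U W\<close> evaluates \<open>W\<close> on \<open>Pi1 U U\<close> only, so it is a statement about the body \<open>U\<close> with the
  restricted response functional.\<close>

definition locally_homogeneous :: "(real^3) set \<Rightarrow> (3 jet \<Rightarrow> 'v::real_normed_vector) \<Rightarrow> bool" where
  "locally_homogeneous B W \<longleftrightarrow>
     (\<exists>\<U>. (\<forall>U\<in>\<U>. open U \<and> U \<subseteq> B \<and> homogeneous U W) \<and> \<Union>\<U> = B)"

end

theory Submission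
  imports Defs
begin

text \<open>Put \<open>w X F = W (X, X, F)\<close>. A triple \<open>(X, Y, P)\<close> is a material isomorphism iff
  \<open>w X (F P) = w Y F\<close> for all invertible \<open>F\<close>, and the following arguments are carried out in the
  coordinates of a chart \<open>\<phi>\<close>.

  If the algebroid is integrable, every \<open>(v, 0)\<close> is the velocity at a unit of a curve
  \<open>(a t, b t, P t)\<close> of material isomorphisms with \<open>b' 0 = 0\<close> and \<open>P' 0 = 0\<close>. Differentiating
  \<open>w (a t) (F P t) = w (b t) F\<close> at \<open>0\<close> gives \<open>\<partial>w/\<partial>x = 0\<close>. Hence \<open>w\<close> is locally independent of the
  point and \<open>\<phi>\<close> is a homogeneous configuration of a small neighbourhood; no differential equation has
  to be solved.

  If the body is homogeneous, the material groupoid is \<open>B \<times> B \<times> G\<close> in the coordinates of the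
  homogeneous configuration, where \<open>G\<close> is closed in the general linear group. The groupoid carries a
  manifold topology \<open>T\<close> that might a priori be strictly finer. By Baire's theorem the groupoid is an
  embedded submanifold on some nonempty open piece, with the dimension \<open>k\<close> of \<open>T\<close>. Intersecting that
  piece transversally with a fibre \<open>{X} \<times> {Y} \<times> GL\<close> straightens \<open>G\<close> near one point, and so near
  all its points, with dimension \<open>k - 2 n\<close>; this replaces the closed subgroup theorem. The tangent
  spaces of \<open>T\<close> at units are contained in \<open>UNIV \<times> UNIV \<times> \<gg>\<close>, and the dimensions agree.\<close>

subsection \<open>Smooth maps\<close>

text \<open>Since \<open>S\<close> is open, values outside \<open>S\<close> do not affect the full
  derivative at its points.\<close>

lemma Ck_on_cong:
  assumes "open S" "\<And>x. x \<in> S \<Longrightarrow> f x = g x" "Ck_on k S f"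
  shows "Ck_on k S g"
  using assms(2,3)
proof (induction k arbitrary: f g)
  case 0
  then show ?case by (simp cong: continuous_on_cong)
next
  case (Suc k)
  have der: "(g has_derivative frechet_derivative f (at x)) (at x)" if "x \<in> S" for x
    by (rule has_derivative_transform_within_open[of f])
      (use Suc.prems that \<open>open S\<close> frechet_derivative_works in auto)
  have eq: "frechet_derivative f (at x) = frechet_derivative g (at x)" if "x \<in> S" for x
    using der[OF that] by (rule frechet_derivative_at)
  have "Ck_on k S (\<lambda>x. frechet_derivative g (at x) v)" for v
    by (rule Suc.IH[of "\<lambda>x. frechet_derivative f (at x) v"]) (use Suc.prems eq in auto)
  then show ?case
    using der by (auto simp: differentiable_def)
qed

text \<open>By uniqueness of derivatives, any explicitly given derivative may take the place of the
  chosen \<open>frechet_derivative\<close>.\<close>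

lemma Ck_on_SucI:
  assumes "open S" "\<And>x. x \<in> S \<Longrightarrow> (f has_derivative f' x) (at x)"
    and "\<And>v. Ck_on k S (\<lambda>x. f' x v)"
  shows "Ck_on (Suc k) S f"
proof -
  have eq: "f' x = frechet_derivative f (at x)" if "x \<in> S" for x
    using assms(2)[OF that] by (rule frechet_derivative_at)
  have "Ck_on k S (\<lambda>x. frechet_derivative f (at x) v)" for v
    by (rule Ck_on_cong[OF assms(1) _ assms(3)[of v]]) (simp add: eq)
  then show ?thesis
    using assms(2) by (auto simp: differentiable_def)
qed

lemma Ck_on_has_derivative:
  assumes "Ck_on (Suc k) S f" "x \<in> S"
  shows "(f has_derivative frechet_derivative f (at x)) (at x)"
  using assms frechet_derivative_works by auto

lemma Ck_on_subset:
  assumes "Ck_on k S f" "S' \<subseteq> S"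
  shows "Ck_on k S' f"
  using assms by (induction k arbitrary: f) (auto intro: continuous_on_subset)

lemma Ck_on_continuous_on:
  assumes "Ck_on k S f"
  shows "continuous_on S f"
  using assms
  by (cases k) (auto simp: differentiable_imp_continuous_within continuous_at_imp_continuous_on)

lemma Ck_on_SucD:
  assumes "Ck_on (Suc k) S f"
  shows "Ck_on k S f"
  using assms
proof (induction k arbitrary: f)
  case 0
  show ?case using Ck_on_continuous_on[OF 0] by simp
next
  case (Suc k)
  then show ?case by (metis Ck_on.simps(2))
qed

lemma Ck_on_const: "open S \<Longrightarrow> Ck_on k S (\<lambda>x. c)"
proof (induction k arbitrary: c)
  case (Suc k)
  show ?case by (rule Ck_on_SucI[where f' = "\<lambda>x v. 0"]) (use Suc in auto)
qed simp

lemma Ck_on_bounded_linear_comp: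
  assumes "bounded_linear h" "open S" "Ck_on k S f"
  shows "Ck_on k S (\<lambda>x. h (f x))"
  using assms(3)
proof (induction k arbitrary: f)
  case 0
  then show ?case
    using assms(1) by (simp add: bounded_linear.continuous_on)
next
  case (Suc k)
  show ?case
  proof (rule Ck_on_SucI[OF assms(2)])
    show "((\<lambda>x. h (f x)) has_derivative (\<lambda>v. h (frechet_derivative f (at x) v))) (at x)" if "x \<in> S" for x
      using Ck_on_has_derivative[OF Suc.prems that] assms(1) by (rule bounded_linear.has_derivative[rotated])
    show "Ck_on k S (\<lambda>x. h (frechet_derivative f (at x) v))" for v
      using Suc by auto
  qed
qed

lemma Ck_on_bounded_linear:
  assumes "bounded_linear h" "open S"
  shows "Ck_on k S h"
proof (cases k)
  case 0
  then show ?thesis using assms by (simp add: linear_continuous_on)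
next
  case (Suc k)
  show ?thesis unfolding Suc
    by (rule Ck_on_SucI[OF assms(2), where f' = "\<lambda>x. h"])
      (use assms in \<open>auto intro: bounded_linear_imp_has_derivative Ck_on_const\<close>)
qed

lemma Ck_on_add:
  assumes "open S" "Ck_on k S f" "Ck_on k S g"
  shows "Ck_on k S (\<lambda>x. f x + g x)"
  using assms(2,3)
proof (induction k arbitrary: f g)
  case 0
  then show ?case by (simp add: continuous_on_add)
next
  case (Suc k)
  show ?case
    by (rule Ck_on_SucI[OF assms(1) has_derivative_add[OF Ck_on_has_derivative[OF Suc.prems(1)] Ck_on_has_derivative[OF Suc.prems(2)]]])
      (use Suc in auto)
qed

lemma Ck_on_sum:
  assumes "open S" "\<And>i. i \<in> I \<Longrightarrow> Ck_on k S (f i)"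
  shows "Ck_on k S (\<lambda>x. \<Sum>i\<in>I. f i x)"
  using assms(2)
  by (induction I rule: infinite_finite_induct) (auto intro: Ck_on_add Ck_on_const assms(1))

lemma Ck_on_bounded_bilinear:
  assumes "bounded_bilinear pr" "open S" "Ck_on k S f" "Ck_on k S g"
  shows "Ck_on k S (\<lambda>x. pr (f x) (g x))"
  using assms(3,4)
proof (induction k arbitrary: f g)
  case 0
  then show ?case
    using assms(1) by (simp add: bounded_bilinear.continuous_on)
next
  case (Suc k)
  show ?case
  proof (rule Ck_on_SucI[OF assms(2)])
    show "((\<lambda>x. pr (f x) (g x)) has_derivative
        (\<lambda>v. pr (f x) (frechet_derivative g (at x) v) + pr (frechet_derivative f (at x) v) (g x))) (at x)"
      if "x \<in> S" for x
      by (rule bounded_bilinear.FDERIV[OF assms(1)]) (use Suc.prems that Ck_on_has_derivative in blast)+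
    show "Ck_on k S (\<lambda>x. pr (f x) (frechet_derivative g (at x) v) + pr (frechet_derivative f (at x) v) (g x))" for v
      by (rule Ck_on_add[OF assms(2) Suc.IH Suc.IH]) (use Suc.prems Ck_on_SucD in auto)
  qed
qed

lemma linear_basis_expansion:
  fixes f :: "'a::euclidean_space \<Rightarrow> 'b::real_normed_vector"
  assumes "linear f"
  shows "f v = (\<Sum>b\<in>Basis. (v \<bullet> b) *\<^sub>R f b)"
  by (subst (1) euclidean_representation[of v, symmetric])
    (simp add: linear_sum[OF assms] linear_cmul[OF assms])

lemma Ck_on_compose:
  fixes f :: "'a::euclidean_space \<Rightarrow> 'b::euclidean_space" and g :: "'b \<Rightarrow> 'c::real_normed_vector"
  assumes "open S" "Ck_on k S f" "Ck_on k T g" "f ` S \<subseteq> T"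
  shows "Ck_on k S (\<lambda>x. g (f x))"
  using assms(2,3)
proof (induction k arbitrary: g)
  case 0
  then show ?case using assms(4) by (auto intro: continuous_on_compose2)
next
  case (Suc k)
  have dg: "(g has_derivative frechet_derivative g (at y)) (at y)" if "y \<in> T" for y
    using Suc.prems(2) that by (rule Ck_on_has_derivative)
  have chain: "((\<lambda>x. g (f x)) has_derivative (\<lambda>v. frechet_derivative g (at (f x)) (frechet_derivative f (at x) v))) (at x)"
    if "x \<in> S" for x
    by (rule has_derivative_compose[OF Ck_on_has_derivative[OF Suc.prems(1) that] dg]) (use that assms(4) in auto)
  \<comment> \<open>The chain rule evaluates the derivative of \<open>g\<close> in a direction that
    varies with \<open>x\<close>, while the induction hypothesis concerns fixed directions.
    Expanding in the basis separates the two dependences.\<close>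
  have "Ck_on k S (\<lambda>x. \<Sum>b\<in>Basis. (frechet_derivative f (at x) v \<bullet> b) *\<^sub>R frechet_derivative g (at (f x)) b)" for v
  proof (intro Ck_on_sum assms(1) Ck_on_bounded_bilinear[OF bounded_bilinear_scaleR])
    fix b :: 'b
    show "Ck_on k S (\<lambda>x. frechet_derivative f (at x) v \<bullet> b)"
      by (rule Ck_on_bounded_linear_comp[OF bounded_linear_inner_left assms(1)]) (use Suc.prems in auto)
    show "Ck_on k S (\<lambda>x. frechet_derivative g (at (f x)) b)"
      by (rule Suc.IH) (use Suc.prems Ck_on_SucD in auto)
  qed
  then have "Ck_on k S (\<lambda>x. frechet_derivative g (at (f x)) (frechet_derivative f (at x) v))" for v
    by (rule Ck_on_cong[OF assms(1), rotated])
      (use assms(4) dg in \<open>auto intro!: linear_basis_expansion[symmetric] has_derivative_linear\<close>)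
  with assms(1) chain show ?case by (rule Ck_on_SucI)
qed

section \<open>Inverses of linear maps depending on a parameter\<close>

text \<open>\<open>L a\<close> is bounded below by some \<open>c > 0\<close>. Once
  \<open>L x\<close> is within \<open>c / 2\<close> of \<open>L a\<close> in operator norm, it is
  still bounded below by \<open>c / 2\<close>, and the change of the inverse is controlled by the
  distance of \<open>L x\<close> from \<open>L a\<close>.\<close>

lemma continuous_on_inverse_linear_family:
  fixes L :: "'a::t2_space \<Rightarrow> 'b::euclidean_space \<Rightarrow> 'b"
  assumes lin: "\<And>x. x \<in> S \<Longrightarrow> linear (L x)" and inj: "\<And>x. x \<in> S \<Longrightarrow> inj (L x)"
    and cont: "\<And>v. continuous_on S (\<lambda>x. L x v)"
  shows "continuous_on S (\<lambda>x. inv (L x) v)"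
  unfolding continuous_on_def
proof
  fix a assume a: "a \<in> S"
  have bij: "bij (L x)" if "x \<in> S" for x
    using linear_injective_imp_surjective[OF lin[OF that] inj[OF that]] inj[OF that]
    by (simp add: bij_def)
  obtain c where c: "c > 0" "\<And>h. norm (L a h) \<ge> c * norm h"
    using linear_inj_bounded_below_pos[OF lin[OF a] inj[OF a]] by (metis mult.commute)
  let ?F = "at a within S"
  \<comment> \<open>\<open>M x\<close> bounds the operator norm of \<open>L x - L a\<close>; it
    tends to 0 because only finitely many basis vectors enter.\<close>
  define M where "M x = (\<Sum>b\<in>Basis. norm (L x b - L a b))" for x
  have "((\<lambda>x. M x) \<longlongrightarrow> (\<Sum>b\<in>Basis. norm (L a (b::'b) - L a b))) ?F"
    unfolding M_def using cont a by (intro tendsto_intros) (auto simp: continuous_on_def)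
  then have M0: "(M \<longlongrightarrow> 0) ?F" by simp
  have diffbd: "norm (L x h - L a h) \<le> M x * norm h" if "x \<in> S" for x h
  proof -
    have lin': "linear (\<lambda>h. L x h - L a h)"
      using lin[OF that] lin[OF a] by (rule linear_compose_sub)
    have "norm (L x h - L a h) = norm (\<Sum>b\<in>Basis. (h \<bullet> b) *\<^sub>R (L x b - L a b))"
      using linear_basis_expansion[OF lin', of h] by simp
    also have "\<dots> \<le> (\<Sum>b\<in>Basis. norm ((h \<bullet> b) *\<^sub>R (L x b - L a b)))" by (rule norm_sum)
    also have "\<dots> \<le> (\<Sum>b\<in>Basis. norm h * norm (L x b - L a b))"
      by (intro sum_mono) (auto intro!: mult_right_mono Basis_le_norm)
    finally show ?thesis by (simp add: M_def sum_distrib_left mult.commute)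
  qed
  define u where "u = inv (L a) v"
  have Lau: "L a u = v" using bij[OF a] by (simp add: u_def bij_is_surj surj_f_inv_f)
  have ev: "\<forall>\<^sub>F x in ?F. M x < c / 2 \<and> x \<in> S"
    using order_tendstoD(2)[OF M0, of "c/2"] c by (auto simp: eventually_at_topological)
  have "\<forall>\<^sub>F x in ?F. norm (inv (L x) v - u) \<le> 2 / c * (M x * norm u)"
    using ev
  proof eventually_elim
    case (elim x)
    define h where "h = inv (L x) v - u"
    have Lxh: "L x h = L a u - L x u"
      using bij[of x] elim lin[of x] Lau by (simp add: h_def linear_diff bij_is_surj surj_f_inv_f)
    have "c * norm h \<le> norm (L a h)" by (rule c)
    also have "\<dots> \<le> norm (L x h) + norm (L x h - L a h)"
      by (metis norm_minus_commute norm_triangle_sub)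
    also have "\<dots> \<le> norm (L x u - L a u) + M x * norm h"
      using diffbd[of x h] elim by (simp add: Lxh norm_minus_commute)
    also have "\<dots> \<le> M x * norm u + c / 2 * norm h"
      using diffbd[of x u] elim by (intro add_mono mult_right_mono) auto
    finally have "norm h * c \<le> 2 * (M x * norm u)" by (simp add: field_simps)
    then show ?case using c by (simp add: h_def field_simps)
  qed
  moreover have "((\<lambda>x. 2 / c * (M x * norm u)) \<longlongrightarrow> 0) ?F"
    by (rule tendsto_eq_intros M0 refl)+ simp
  ultimately have "((\<lambda>x. inv (L x) v - u) \<longlongrightarrow> 0) ?F"
    by (rule Lim_null_comparison)
  then show "((\<lambda>x. inv (L x) v) \<longlongrightarrow> inv (L a) v) ?F"
    by (simp add: u_def LIM_zero_iff)
qed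

text \<open>Because the first factor vanishes at \<open>a\<close>, continuity of the second is
  enough for differentiability of the product. This is applied to inverses whose differentiability
  is still to be shown.\<close>

lemma has_derivative_scaleR_zero:
  fixes \<phi> :: "'a::real_normed_vector \<Rightarrow> real" and \<psi> :: "'a \<Rightarrow> 'b::real_normed_vector"
  assumes \<phi>: "(\<phi> has_derivative \<phi>') (at a)" "\<phi> a = 0" and \<psi>: "isCont \<psi> a"
  shows "((\<lambda>x. \<phi> x *\<^sub>R \<psi> x) has_derivative (\<lambda>h. \<phi>' h *\<^sub>R \<psi> a)) (at a)"
proof -
  have bl: "bounded_linear \<phi>'" using \<phi>(1) by (rule has_derivative_bounded_linear)
  obtain K where K: "\<And>h. norm (\<phi>' h) \<le> norm h * K"
    using bounded_linear.bounded[OF bl] by blast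
  let ?q = "\<lambda>y. norm (\<phi> y - \<phi> a - \<phi>' (y - a)) / norm (y - a)"
  have q: "(?q \<longlongrightarrow> 0) (at a)"
    using \<phi>(1) by (simp add: has_derivative_iff_norm)
  have \<psi>': "(\<psi> \<longlongrightarrow> \<psi> a) (at a)" using \<psi> by (simp add: isCont_def)
  have lim: "((\<lambda>y. ?q y * norm (\<psi> y) + K * norm (\<psi> y - \<psi> a)) \<longlongrightarrow> 0) (at a)"
    by (rule tendsto_eq_intros q \<psi>' refl)+ simp
  have "norm (\<phi> y *\<^sub>R \<psi> y - \<phi> a *\<^sub>R \<psi> a - \<phi>' (y - a) *\<^sub>R \<psi> a) / norm (y - a)
      \<le> ?q y * norm (\<psi> y) + K * norm (\<psi> y - \<psi> a)" if "y \<noteq> a" for y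
  proof -
    have "\<phi> y *\<^sub>R \<psi> y - \<phi> a *\<^sub>R \<psi> a - \<phi>' (y - a) *\<^sub>R \<psi> a
        = (\<phi> y - \<phi> a - \<phi>' (y - a)) *\<^sub>R \<psi> y + \<phi>' (y - a) *\<^sub>R (\<psi> y - \<psi> a)"
      using \<phi>(2) by (simp add: algebra_simps)
    then have "norm (\<phi> y *\<^sub>R \<psi> y - \<phi> a *\<^sub>R \<psi> a - \<phi>' (y - a) *\<^sub>R \<psi> a)
        \<le> norm (\<phi> y - \<phi> a - \<phi>' (y - a)) * norm (\<psi> y) + norm (\<phi>' (y - a)) * norm (\<psi> y - \<psi> a)"
      by (metis norm_scaleR norm_triangle_ineq real_norm_def)
    also have "\<dots> \<le> norm (\<phi> y - \<phi> a - \<phi>' (y - a)) * norm (\<psi> y) + (norm (y - a) * K) * norm (\<psi> y - \<psi> a)"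
      by (intro add_left_mono mult_right_mono K) auto
    finally show ?thesis using that by (simp add: field_simps)
  qed
  then have "((\<lambda>y. norm (\<phi> y *\<^sub>R \<psi> y - \<phi> a *\<^sub>R \<psi> a - \<phi>' (y - a) *\<^sub>R \<psi> a) / norm (y - a)) \<longlongrightarrow> 0) (at a)"
    by (intro tendsto_sandwich[OF _ _ tendsto_const lim]) (auto simp: eventually_at_filter)
  then show ?thesis
    by (simp add: has_derivative_iff_norm bounded_linear_scaleR_left[THEN bounded_linear_compose, OF bl])
qed

text \<open>If \<open>L a u = v\<close>, then
  \<open>inv (L y) v = u - inv (L y) (L y u - L a u)\<close>. One factor vanishes at
  \<open>y = a\<close>, so continuity of the inverse already yields its derivative. That derivative
  is built from the inverse and the derivative of \<open>L\<close>, so the order of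
  differentiability rises by induction.\<close>

lemma Ck_on_inverse_linear_family:
  fixes L :: "'a::euclidean_space \<Rightarrow> 'b::euclidean_space \<Rightarrow> 'b"
  assumes S: "open S" and lin: "\<And>x. x \<in> S \<Longrightarrow> linear (L x)" and inj: "\<And>x. x \<in> S \<Longrightarrow> inj (L x)"
    and "\<And>v. Ck_on k S (\<lambda>x. L x v)"
  shows "Ck_on k S (\<lambda>x. inv (L x) v)"
  using assms(4)
proof (induction k arbitrary: v)
  case 0
  show ?case
    unfolding Ck_on.simps by (rule continuous_on_inverse_linear_family[OF lin inj Ck_on_continuous_on[OF 0]])
next
  case (Suc k)
  have IH: "Ck_on k S (\<lambda>x. inv (L x) v)" for v
    using Suc Ck_on_SucD by blast
  have cont: "isCont (\<lambda>x. inv (L x) v) a" if "a \<in> S" for a v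
    using Ck_on_continuous_on[OF IH] S that continuous_on_eq_continuous_at by blast
  have bij: "bij (L x)" if "x \<in> S" for x
    using linear_injective_imp_surjective[OF lin[OF that] inj[OF that]] inj[OF that]
    by (simp add: bij_def)
  have lininv: "linear (inv (L x))" if "x \<in> S" for x
    using bij[OF that] lin[OF that] by (metis bij_def inj_linear_imp_inv_linear)
  let ?D = "\<lambda>b x. frechet_derivative (\<lambda>x. L x b) (at x)"
  \<comment> \<open>The familiar formula for the derivative of an inverse, minus the inverse applied
    to the derivative of \<open>L\<close> at the vector \<open>inv (L x) v\<close>, written out in
    bases.\<close>
  let ?f' = "\<lambda>x h. - (\<Sum>b\<in>Basis. \<Sum>c\<in>Basis. (inv (L x) v \<bullet> b) *\<^sub>R ((?D b x h \<bullet> c) *\<^sub>R inv (L x) c))"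
  show ?case
  proof (rule Ck_on_SucI[OF S, where f' = ?f'])
    fix a assume a: "a \<in> S"
    define u where "u = inv (L a) v"
    have Lau: "L a u = v" using bij[OF a] by (simp add: u_def bij_is_surj surj_f_inv_f)
    let ?F = "\<lambda>y. u - (\<Sum>b\<in>Basis. \<Sum>c\<in>Basis. (u \<bullet> b) *\<^sub>R (((L y b - L a b) \<bullet> c) *\<^sub>R inv (L y) c))"
    have F: "?F y = inv (L y) v" if y: "y \<in> S" for y
    proof -
      have expand: "inv (L y) (L y b - L a b) = (\<Sum>c\<in>Basis. ((L y b - L a b) \<bullet> c) *\<^sub>R inv (L y) c)" for b
        by (rule linear_basis_expansion[OF lininv[OF y]])
      have "(\<Sum>b\<in>Basis. \<Sum>c\<in>Basis. (u \<bullet> b) *\<^sub>R (((L y b - L a b) \<bullet> c) *\<^sub>R inv (L y) c))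
          = (\<Sum>b\<in>Basis. (u \<bullet> b) *\<^sub>R inv (L y) (L y b - L a b))"
        by (simp only: expand scaleR_sum_right)
      also have "\<dots> = (\<Sum>b\<in>Basis. inv (L y) ((u \<bullet> b) *\<^sub>R L y b - (u \<bullet> b) *\<^sub>R L a b))"
        by (simp add: linear_cmul[OF lininv[OF y], symmetric] scaleR_diff_right)
      also have "\<dots> = inv (L y) ((\<Sum>b\<in>Basis. (u \<bullet> b) *\<^sub>R L y b) - (\<Sum>b\<in>Basis. (u \<bullet> b) *\<^sub>R L a b))"
        by (simp add: linear_sum[OF lininv[OF y], symmetric] sum_subtractf)
      also have "\<dots> = inv (L y) (L y u - v)"
        using linear_basis_expansion[OF lin[OF y], of u] linear_basis_expansion[OF lin[OF a], of u] Lau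
        by simp
      also have "\<dots> = u - inv (L y) v"
        using inj[OF y] by (simp add: linear_diff[OF lininv[OF y]])
      finally show ?thesis by simp
    qed
    have "((\<lambda>y. ((L y b - L a b) \<bullet> c) *\<^sub>R inv (L y) c) has_derivative (\<lambda>h. (?D b a h \<bullet> c) *\<^sub>R inv (L a) c)) (at a)" for b c
    proof (rule has_derivative_scaleR_zero)
      have "((\<lambda>y. L y b - L a b) has_derivative ?D b a) (at a)"
        using has_derivative_diff[OF Ck_on_has_derivative[OF Suc.prems[of b] a] has_derivative_const[of "L a b"]] by simp
      then show "((\<lambda>y. (L y b - L a b) \<bullet> c) has_derivative (\<lambda>h. ?D b a h \<bullet> c)) (at a)"
        by (rule has_derivative_inner_left)
    qed (use cont[OF a] in auto)
    then have "(?F has_derivative (\<lambda>h. 0 - (\<Sum>b\<in>Basis. \<Sum>c\<in>Basis. (u \<bullet> b) *\<^sub>R ((?D b a h \<bullet> c) *\<^sub>R inv (L a) c)))) (at a)"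
      by (intro has_derivative_diff has_derivative_const has_derivative_sum has_derivative_scaleR_right)
    then have "((\<lambda>x. inv (L x) v) has_derivative (\<lambda>h. 0 - (\<Sum>b\<in>Basis. \<Sum>c\<in>Basis. (u \<bullet> b) *\<^sub>R ((?D b a h \<bullet> c) *\<^sub>R inv (L a) c)))) (at a)"
      by (rule has_derivative_transform_within_open[OF _ S a F])
    then show "((\<lambda>x. inv (L x) v) has_derivative ?f' a) (at a)"
      by (simp add: u_def)
  next
    fix h
    have D: "Ck_on k S (\<lambda>x. ?D b x h)" for b
      using Suc.prems[of b] by simp
    have "Ck_on k S (\<lambda>x. (inv (L x) v \<bullet> b) *\<^sub>R ((?D b x h \<bullet> c) *\<^sub>R inv (L x) c))" for b c
      by (rule Ck_on_bounded_bilinear[OF bounded_bilinear_scaleR S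
            Ck_on_bounded_linear_comp[OF bounded_linear_inner_left S IH]
            Ck_on_bounded_bilinear[OF bounded_bilinear_scaleR S
              Ck_on_bounded_linear_comp[OF bounded_linear_inner_left S D] IH]])
    then have "Ck_on k S (\<lambda>x. \<Sum>b\<in>Basis. \<Sum>c\<in>Basis. (inv (L x) v \<bullet> b) *\<^sub>R ((?D b x h \<bullet> c) *\<^sub>R inv (L x) c))"
      by (intro Ck_on_sum S)
    then show "Ck_on k S (\<lambda>x. ?f' x h)"
      by (rule Ck_on_bounded_linear_comp[OF bounded_linear_minus[OF bounded_linear_ident] S])
  qed
qed

section \<open>Closure properties of smooth maps\<close>

lemma smooth_on_cong:
  "open S \<Longrightarrow> (\<And>x. x \<in> S \<Longrightarrow> f x = g x) \<Longrightarrow> smooth_on S f \<Longrightarrow> smooth_on S g"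
  unfolding smooth_on_def using Ck_on_cong by blast

lemma smooth_on_subset: "smooth_on S f \<Longrightarrow> S' \<subseteq> S \<Longrightarrow> smooth_on S' f"
  unfolding smooth_on_def using Ck_on_subset by blast

lemma smooth_on_has_derivative:
  "smooth_on S f \<Longrightarrow> x \<in> S \<Longrightarrow> (f has_derivative frechet_derivative f (at x)) (at x)"
  unfolding smooth_on_def using Ck_on_has_derivative by blast

lemma smooth_on_continuous_on: "smooth_on S f \<Longrightarrow> continuous_on S f"
  unfolding smooth_on_def using Ck_on_continuous_on by blast

lemma smooth_on_frechet_derivative:
  "smooth_on S f \<Longrightarrow> smooth_on S (\<lambda>x. frechet_derivative f (at x) v)"
  unfolding smooth_on_def by (metis Ck_on.simps(2))

lemma smooth_on_const: "open S \<Longrightarrow> smooth_on S (\<lambda>x. c)"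
  by (simp add: smooth_on_def Ck_on_const)

lemma smooth_on_bounded_linear: "bounded_linear h \<Longrightarrow> open S \<Longrightarrow> smooth_on S h"
  by (simp add: smooth_on_def Ck_on_bounded_linear)

lemma smooth_on_linear:
  fixes h :: "'a::euclidean_space \<Rightarrow> 'b::real_normed_vector"
  shows "linear h \<Longrightarrow> open S \<Longrightarrow> smooth_on S h"
  by (simp add: smooth_on_bounded_linear linear_conv_bounded_linear)

lemma smooth_on_ident: "open S \<Longrightarrow> smooth_on S (\<lambda>x. x)"
  by (rule smooth_on_bounded_linear[OF bounded_linear_ident])

lemma smooth_on_bounded_linear_comp:
  "bounded_linear h \<Longrightarrow> open S \<Longrightarrow> smooth_on S f \<Longrightarrow> smooth_on S (\<lambda>x. h (f x))"
  by (simp add: smooth_on_def Ck_on_bounded_linear_comp)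

lemma smooth_on_add: "open S \<Longrightarrow> smooth_on S f \<Longrightarrow> smooth_on S g \<Longrightarrow> smooth_on S (\<lambda>x. f x + g x)"
  by (simp add: smooth_on_def Ck_on_add)

lemma smooth_on_sum:
  "open S \<Longrightarrow> (\<And>i. i \<in> I \<Longrightarrow> smooth_on S (f i)) \<Longrightarrow> smooth_on S (\<lambda>x. \<Sum>i\<in>I. f i x)"
  by (simp add: smooth_on_def Ck_on_sum)

lemma smooth_on_bounded_bilinear:
  "bounded_bilinear pr \<Longrightarrow> open S \<Longrightarrow> smooth_on S f \<Longrightarrow> smooth_on S g \<Longrightarrow> smooth_on S (\<lambda>x. pr (f x) (g x))"
  by (simp add: smooth_on_def Ck_on_bounded_bilinear)

lemma smooth_on_compose:
  fixes f :: "'a::euclidean_space \<Rightarrow> 'b::euclidean_space" and g :: "'b \<Rightarrow> 'c::real_normed_vector"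
  shows "open S \<Longrightarrow> smooth_on S f \<Longrightarrow> smooth_on T g \<Longrightarrow> f ` S \<subseteq> T \<Longrightarrow> smooth_on S (\<lambda>x. g (f x))"
  unfolding smooth_on_def using Ck_on_compose by blast

lemma smooth_on_Pair:
  assumes "open S" "smooth_on S f" "smooth_on S g"
  shows "smooth_on S (\<lambda>x. (f x, g x))"
proof -
  have "smooth_on S (\<lambda>x. (f x, 0) + (0, g x))"
    by (intro smooth_on_add assms smooth_on_bounded_linear_comp
        [of "\<lambda>y. (y, 0)", OF bounded_linear_Pair[OF bounded_linear_ident bounded_linear_zero]]
        smooth_on_bounded_linear_comp
        [of "\<lambda>y. (0, y)", OF bounded_linear_Pair[OF bounded_linear_zero bounded_linear_ident]])
  then show ?thesis by simp
qed

section \<open>Smooth inverses and the inverse function theorem\<close>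

text \<open>Bootstrapping: the derivative of \<open>g\<close> at \<open>y\<close> is the inverse of
  the derivative of \<open>f\<close> at \<open>g y\<close>, so if \<open>g\<close> is of class C^k,
  then so is its derivative.\<close>

lemma smooth_on_inverse_map:
  fixes f :: "'a::euclidean_space \<Rightarrow> 'a"
  assumes "open S" "open V" "smooth_on S f" "\<And>x. x \<in> S \<Longrightarrow> inj (frechet_derivative f (at x))"
    and gS: "g ` V \<subseteq> S"
    and g: "\<And>y. y \<in> V \<Longrightarrow> (g has_derivative inv (frechet_derivative f (at (g y)))) (at y)"
  shows "smooth_on V g"
proof -
  have lin: "linear (frechet_derivative f (at x))" if "x \<in> S" for x
    using smooth_on_has_derivative[OF assms(3) that] by (rule has_derivative_linear)
  have "Ck_on k V g" for k
  proof (induction k)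
    case 0
    show ?case
      using g by (auto intro!: continuous_at_imp_continuous_on has_derivative_continuous)
  next
    case (Suc k)
    have "Ck_on k V (\<lambda>y. frechet_derivative f (at (g y)) v)" for v
      by (rule Ck_on_compose[OF assms(2) Suc _ gS])
        (use smooth_on_frechet_derivative[OF assms(3)] in \<open>simp add: smooth_on_def\<close>)
    then have "Ck_on k V (\<lambda>y. inv (frechet_derivative f (at (g y))) v)" for v
      using gS lin assms(4) by (intro Ck_on_inverse_linear_family assms(2)) auto
    then show ?case by - (rule Ck_on_SucI[OF assms(2) g])
  qed
  then show ?thesis by (simp add: smooth_on_def)
qed

text \<open>Invariance of domain makes the image open, invertibility of the derivatives makes the
  inverse differentiable, and bootstrapping makes it smooth.\<close>

lemma diffeomorphism_image:
  fixes f :: "'a::euclidean_space \<Rightarrow> 'a"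
  assumes "open S" "smooth_on S f" "inj_on f S" "\<And>x. x \<in> S \<Longrightarrow> inj (frechet_derivative f (at x))"
  shows "diffeomorphism S (f ` S) f"
proof -
  have cont: "continuous_on S f" using assms(2) by (rule smooth_on_continuous_on)
  have opn: "open (f ` S)" using cont assms(1,3) by (rule invariance_of_domain)
  have "(inv_into S f has_derivative inv (frechet_derivative f (at (inv_into S f y)))) (at y)"
    if y: "y \<in> f ` S" for y
  proof -
    define x where "x = inv_into S f y"
    have x: "x \<in> S" "f x = y" using y by (auto simp: x_def inv_into_into f_inv_into_f)
    have der: "(f has_derivative frechet_derivative f (at x)) (at x)"
      using assms(2) x(1) by (rule smooth_on_has_derivative)
    have "frechet_derivative f (at x) \<circ> inv (frechet_derivative f (at x)) = id"
      using linear_injective_imp_surjective[OF has_derivative_linear[OF der] assms(4)[OF x(1)]]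
      by (simp add: surj_iff)
    then have "(inv_into S f has_derivative inv (frechet_derivative f (at x))) (at (f x))"
      by (intro has_derivative_inverse_strong[OF assms(1) x(1) cont _ der]) (simp add: assms(3))
    then show ?thesis by (simp add: x x_def[symmetric])
  qed
  then have "smooth_on (f ` S) (inv_into S f)"
    by (intro smooth_on_inverse_map[OF assms(1) opn assms(2,4)]) (auto simp: inv_into_into)
  then show ?thesis
    using assms opn by (simp add: diffeomorphism_def inj_on_imp_bij_betw)
qed

text \<open>The C^1 inverse function theorem supplies a neighbourhood on which \<open>f\<close> is
  injective with bijective derivatives; \<open>diffeomorphism_image\<close> upgrades this to
  smoothness of the inverse.\<close>

lemma smooth_local_diffeomorphism:
  fixes f :: "'a::euclidean_space \<Rightarrow> 'a"
  assumes "open S" "smooth_on S f" "x0 \<in> S" "inj (frechet_derivative f (at x0))"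
  obtains U where "open U" "x0 \<in> U" "U \<subseteq> S" "diffeomorphism U (f ` U) f"
proof -
  \<comment> \<open>The derivative as an element of the normed space of bounded operators; its
    continuity there reduces to that of the directional derivatives along a basis.\<close>
  define f' where "f' x = Blinfun (frechet_derivative f (at x))" for x
  have der: "(f has_derivative frechet_derivative f (at x)) (at x)" if "x \<in> S" for x
    using assms(2) that by (rule smooth_on_has_derivative)
  have f': "blinfun_apply (f' x) = frechet_derivative f (at x)" if "x \<in> S" for x
    using has_derivative_bounded_linear[OF der[OF that]] by (simp add: f'_def bounded_linear_Blinfun_apply)
  have contf': "continuous_on S f'"
  proof (rule continuous_on_blinfun_componentwise)
    fix i :: 'a
    have "continuous_on S (\<lambda>x. frechet_derivative f (at x) i)"
      using smooth_on_continuous_on[OF smooth_on_frechet_derivative[OF assms(2)]] .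
    then show "continuous_on S (\<lambda>x. blinfun_apply (f' x) i)"
      by (rule continuous_on_eq) (simp add: f')
  qed
  let ?D = "frechet_derivative f (at x0)"
  have linD: "linear ?D" using der[OF assms(3)] by (rule has_derivative_linear)
  have "linear (inv ?D)"
    using linear_injective_imp_surjective[OF linD assms(4)] assms(4) linD by (metis inj_linear_imp_inv_linear)
  then have bl: "bounded_linear (inv ?D)" by (simp add: linear_conv_bounded_linear)
  have invf: "Blinfun (inv ?D) o\<^sub>L f' x0 = id_blinfun"
    by (rule blinfun_eqI) (simp add: bounded_linear_Blinfun_apply[OF bl] f'[OF assms(3)] assms(4))
  have derf: "(f has_derivative blinfun_apply (f' x)) (at x)" if "x \<in> S" for x
    using der[OF that] by (simp add: f'[OF that])
  show thesis
  proof (rule inverse_function_theorem[OF assms(1) derf contf' assms(3) invf])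
    fix U V g g'
    assume U: "open U" "U \<subseteq> S" "x0 \<in> U" and hom: "homeomorphism U V f g"
      and bij: "\<And>y. y \<in> V \<Longrightarrow> bij (blinfun_apply (f' (g y)))"
    have "inj_on f U" using hom by (metis homeomorphism_def inj_on_inverseI)
    moreover have "inj (frechet_derivative f (at x))" if "x \<in> U" for x
    proof -
      have "f x \<in> V" "g (f x) = x" using hom that by (auto simp: homeomorphism_def)
      with bij[of "f x"] f'[of x] U that show ?thesis by (auto simp: bij_def)
    qed
    ultimately have "diffeomorphism U (f ` U) f"
      using diffeomorphism_image[OF U(1) smooth_on_subset[OF assms(2) U(2)]] by blast
    then show thesis by (rule that[OF U(1,3,2)])
  qed
qed

subsection \<open>Submanifolds and tangent spaces\<close>

text \<open>Subtracting a linear retraction onto \<open>L\<close> from the identity turns membership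
  in \<open>L\<close> into a linear equation, which can be differentiated.\<close>

lemma exists_linear_kernel_eq_subspace:
  fixes L :: "'a::euclidean_space set"
  assumes "subspace L"
  obtains q :: "'a \<Rightarrow> 'a" where "linear q" "\<And>x. q x = 0 \<longleftrightarrow> x \<in> L"
proof -
  obtain g :: "'a \<Rightarrow> 'a" where g: "range g \<subseteq> L" "linear g" "\<And>v. v \<in> L \<Longrightarrow> g v = v"
    using linear_exists_right_inverse_on[of "\<lambda>x::'a. x" L] assms linear_id by (auto simp: id_def)
  have "linear (\<lambda>x. x - g x)"
    by (rule linear_compose_sub[OF linear_id[unfolded id_def] g(2)])
  moreover have "x - g x = 0 \<longleftrightarrow> x \<in> L" for x
    using g by auto
  ultimately show thesis by (rule that)
qed

text \<open>Rank-nullity: a linear right inverse \<open>s\<close> on the range maps it onto a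
  complement of the kernel.\<close>

lemma dim_kernel_plus_dim_range:
  fixes f :: "'a::euclidean_space \<Rightarrow> 'b::euclidean_space"
  assumes f: "linear f"
  shows "dim {x. f x = 0} + dim (range f) = DIM('a)"
proof -
  obtain s :: "'b \<Rightarrow> 'a" where s: "linear s" "\<And>v. v \<in> range f \<Longrightarrow> f (s v) = v"
    using linear_exists_right_inverse_on[OF f subspace_UNIV] by blast
  have ker: "subspace {x. f x = 0}" using f by (rule linear_subspace_kernel)
  have ran: "subspace (range f)" using f subspace_UNIV by (rule linear_subspace_image)
  have sran: "subspace (s ` range f)" using s(1) ran by (rule linear_subspace_image)
  have "{x + y |x y. x \<in> {x. f x = 0} \<and> y \<in> s ` range f} = UNIV"
  proof (intro set_eqI iffI UNIV_I)
    fix x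
    have "x = (x - s (f x)) + s (f x)" "f (x - s (f x)) = 0"
      using s by (auto simp: linear_diff[OF f])
    then show "x \<in> {x + y |x y. x \<in> {x. f x = 0} \<and> y \<in> s ` range f}" by blast
  qed
  moreover have "{x. f x = 0} \<inter> s ` range f = {0}"
    using s by (auto simp: linear_0 linear_0[OF s(1)] image_iff)
      (metis linear_0[OF f] linear_0[OF s(1)])+
  moreover have "dim (s ` range f) = dim (range f)"
    by (rule dim_image_eq[OF s(1)]) (use s(2) ran in \<open>metis inj_onI span_eq_iff\<close>)
  ultimately show ?thesis
    using dim_sums_Int[OF ker sran] by simp
qed

text \<open>The linear equation \<open>q\<close> of \<open>L\<close> vanishes along the curve near
  0, hence so does its derivative.\<close>

lemma vector_derivative_in_subspace:
  fixes f :: "real \<Rightarrow> 'a::euclidean_space"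
  assumes "subspace L" "(f has_vector_derivative d) (at 0)" "\<forall>\<^sub>F t in nhds 0. f t \<in> L"
  shows "d \<in> L"
proof -
  obtain q :: "'a \<Rightarrow> 'a" where q: "linear q" "\<And>x. q x = 0 \<longleftrightarrow> x \<in> L"
    using exists_linear_kernel_eq_subspace[OF assms(1)] by blast
  have "((\<lambda>t. q (f t)) has_vector_derivative q d) (at 0)"
    using q(1) assms(2) by (simp add: linear_conv_bounded_linear bounded_linear.has_vector_derivative)
  moreover have "((\<lambda>t. q (f t)) has_vector_derivative 0) (at 0)"
  proof -
    obtain A where A: "open A" "0 \<in> A" "\<And>t. t \<in> A \<Longrightarrow> f t \<in> L"
      using assms(3) by (auto simp: eventually_nhds)
    show ?thesis
      by (rule has_vector_derivative_transform_within_open[of "\<lambda>t. 0" 0 0 A "\<lambda>t. q (f t)"])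
        (use A q(2) in auto)
  qed
  ultimately have "q d = 0" by (rule vector_derivative_unique_at)
  then show ?thesis by (simp add: q)
qed

lemma diffeomorphism_has_derivative_inverse:
  assumes "diffeomorphism U V f" "x \<in> U"
  shows "(inv_into U f has_derivative frechet_derivative (inv_into U f) (at (f x))) (at (f x))"
    and "frechet_derivative (inv_into U f) (at (f x)) (frechet_derivative f (at x) v) = v"
proof -
  have d: "open U" "smooth_on U f" "bij_betw f U V" "smooth_on V (inv_into U f)"
    using assms(1) by (auto simp: diffeomorphism_def)
  have fx: "f x \<in> V" using d(3) assms(2) by (auto simp: bij_betw_def)
  show g: "(inv_into U f has_derivative frechet_derivative (inv_into U f) (at (f x))) (at (f x))"
    using d(4) fx by (rule smooth_on_has_derivative)
  have "((\<lambda>y. inv_into U f (f y)) has_derivative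
      (\<lambda>v. frechet_derivative (inv_into U f) (at (f x)) (frechet_derivative f (at x) v))) (at x)"
    using smooth_on_has_derivative[OF d(2) assms(2)] g by (rule has_derivative_compose)
  then have "((\<lambda>y. y) has_derivative
      (\<lambda>v. frechet_derivative (inv_into U f) (at (f x)) (frechet_derivative f (at x) v))) (at x)"
    by (rule has_derivative_transform_within_open[OF _ d(1) assms(2)])
      (use d(3) in \<open>simp add: bij_betw_inv_into_left\<close>)
  from has_derivative_unique[OF this has_derivative_ident]
  show "frechet_derivative (inv_into U f) (at (f x)) (frechet_derivative f (at x) v) = v" by meson
qed

lemma diffeomorphism_derivative:
  assumes "diffeomorphism U V f" "x \<in> U"
  shows "(f has_derivative frechet_derivative f (at x)) (at x)" "linear (frechet_derivative f (at x))"
    "inj (frechet_derivative f (at x))"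
proof -
  show "(f has_derivative frechet_derivative f (at x)) (at x)"
    using assms smooth_on_has_derivative by (auto simp: diffeomorphism_def)
  then show "linear (frechet_derivative f (at x))" by (rule has_derivative_linear)
  show "inj (frechet_derivative f (at x))"
    using diffeomorphism_has_derivative_inverse(2)[OF assms] by (metis injI)
qed

lemma diffeomorphism_restrict:
  fixes f :: "'a::euclidean_space \<Rightarrow> 'a"
  assumes "diffeomorphism U V f" "open U'" "U' \<subseteq> U"
  shows "diffeomorphism U' (f ` U') f"
proof (rule diffeomorphism_image[OF assms(2)])
  show "smooth_on U' f"
    using assms smooth_on_subset by (auto simp: diffeomorphism_def)
  show "inj_on f U'"
    using assms by (auto simp: diffeomorphism_def bij_betw_def intro: inj_on_subset)
  show "inj (frechet_derivative f (at x))" if "x \<in> U'" for x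
    using diffeomorphism_derivative(3)[OF assms(1)] that assms(3) by blast
qed

section \<open>Tangent spaces of immersed submanifolds\<close>

text \<open>\<open>smooth_map\<close> only provides ambient smooth maps agreeing with the curve
  locally; on a short interval about 0 a single one suffices.\<close>

lemma smooth_curve_imp_smooth_on:
  fixes \<gamma> :: "real \<Rightarrow> 'a::euclidean_space"
  assumes "smooth_map (top_of_set {-e<..<e}) T \<gamma>" "e > 0"
  obtains d where "d > 0" "d \<le> e" "smooth_on {-d<..<d} \<gamma>" "\<gamma> ` {-d<..<d} \<subseteq> topspace T"
proof -
  have "0 \<in> topspace (top_of_set {-e<..<e})" using assms(2) by simp
  then obtain P U g where P: "openin (top_of_set {-e<..<e}) P" "0 \<in> P" "P \<subseteq> U" "open U"
      "smooth_on U g" "\<And>x. x \<in> P \<Longrightarrow> \<gamma> x = g x"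
    using assms(1) unfolding smooth_map_def by metis
  have "open P" using P(1) by (simp add: openin_open_eq)
  then obtain d where d: "d > 0" "\<And>t. \<bar>t\<bar> < d \<Longrightarrow> t \<in> P"
    using P(2) by (auto simp: open_dist dist_real_def)
  let ?d = "min d e"
  have sub: "{-?d<..<?d} \<subseteq> P" by (auto intro!: d(2))
  have "smooth_on {-?d<..<?d} \<gamma>"
    by (rule smooth_on_cong[of _ g]) (use P(3,6) sub smooth_on_subset[OF P(5)] in auto)
  moreover have "\<gamma> ` {-?d<..<?d} \<subseteq> topspace T"
    using assms(1) by (auto simp: smooth_map_def continuous_map_def Pi_iff)
  ultimately show thesis using d assms(2) by (intro that[of ?d]) auto
qed

text \<open>The chart \<open>\<Phi>\<close> flattens the patch \<open>P\<close>. Curves through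
  \<open>p\<close> then have velocities in \<open>L\<close>, and each vector of \<open>L\<close> is
  the velocity of a straight line, pulled back by the inverse chart.\<close>

lemma tangent_space_patch:
  fixes T :: "'a::euclidean_space topology"
  assumes P: "openin T P" "p \<in> P" "subtopology T P = top_of_set P"
    and U: "p \<in> U" "diffeomorphism U V \<Phi>" and L: "subspace L" "\<Phi> ` (U \<inter> P) = V \<inter> L"
  shows "tangent_space T p = {w. frechet_derivative \<Phi> (at p) w \<in> L}"
proof (intro set_eqI iffI; clarify)
  let ?D = "frechet_derivative \<Phi> (at p)"
  have opn: "open U" "open V" and bij: "bij_betw \<Phi> U V"
    and sm: "smooth_on U \<Phi>" "smooth_on V (inv_into U \<Phi>)"
    using U(2) by (auto simp: diffeomorphism_def)
  fix w
  show "?D w \<in> L" if "w \<in> tangent_space T p"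
  proof -
    obtain e \<gamma> where e: "e > 0" and \<gamma>: "smooth_map (top_of_set {-e<..<e}) T \<gamma>" "\<gamma> 0 = p"
      and d: "(\<gamma> has_vector_derivative w) (at 0)"
      using \<open>w \<in> tangent_space T p\<close> by (auto simp: tangent_space_def)
    \<comment> \<open>Continuity into the manifold topology keeps the curve in the patch for small
      times, even if other sheets of the immersed submanifold come close to
      \<open>p\<close>.\<close>
    have "openin (top_of_set {-e<..<e}) {t \<in> {-e<..<e}. \<gamma> t \<in> P}"
      using \<gamma>(1) P(1) openin_continuous_map_preimage by (fastforce simp: smooth_map_def)
    then have "open {t \<in> {-e<..<e}. \<gamma> t \<in> P}" by (simp add: openin_open_eq)
    then have 1: "\<forall>\<^sub>F t in nhds 0. t \<in> {t \<in> {-e<..<e}. \<gamma> t \<in> P}"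
      using e \<gamma>(2) P(2) by (intro eventually_nhds_in_open) auto
    have "isCont \<gamma> 0"
      using d has_vector_derivative_continuous by blast
    then have "(\<gamma> \<longlongrightarrow> p) (nhds 0)"
      using \<gamma>(2) by (metis isCont_def tendsto_at_iff_tendsto_nhds)
    then have 2: "\<forall>\<^sub>F t in nhds 0. \<gamma> t \<in> U"
      using opn(1) U(1) by (rule topological_tendstoD)
    have "\<forall>\<^sub>F t in nhds 0. (\<Phi> \<circ> \<gamma>) t \<in> L"
      using 1 2 by eventually_elim (use L(2) in auto)
    moreover have "((\<Phi> \<circ> \<gamma>) has_vector_derivative ?D w) (at 0)"
      using vector_derivative_diff_chain_within[of \<gamma> w 0 UNIV \<Phi> ?D] d \<gamma>(2)
        has_derivative_at_withinI[OF diffeomorphism_derivative(1)[OF U(2,1)]] by simp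
    ultimately show ?thesis using vector_derivative_in_subspace[OF L(1)] by blast
  qed
  show "w \<in> tangent_space T p" if "?D w \<in> L"
  proof -
    let ?l = "\<lambda>t::real. \<Phi> p + t *\<^sub>R ?D w"
    let ?g = "inv_into U \<Phi>"
    let ?\<gamma> = "\<lambda>t. ?g (?l t)"
    have pU: "\<Phi> p \<in> V \<inter> L" using L(2) U(1) P(2) by blast
    have "open (?l -` V)"
      using opn(2) by (intro open_vimage continuous_intros)
    moreover have "0 \<in> ?l -` V" using pU by simp
    ultimately obtain e where e: "e > 0" "ball 0 e \<subseteq> ?l -` V"
      by (rule openE)
    let ?I = "{-e<..<e}"
    have lI: "?l t \<in> V \<inter> L" if "t \<in> ?I" for t
      using e(2) that pU \<open>?D w \<in> L\<close> L(1) by (force intro: subspace_add subspace_scale simp: dist_real_def)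
    have \<gamma>P: "?\<gamma> t \<in> P" if t: "t \<in> ?I" for t
    proof -
      obtain z where "z \<in> U \<inter> P" "?l t = \<Phi> z" using lI[OF t] L(2) by (metis imageE)
      then show ?thesis using bij by (simp add: bij_betw_inv_into_left)
    qed
    have "smooth_on ?I (\<lambda>t. t *\<^sub>R ?D w)"
      by (rule smooth_on_linear) (auto intro!: linearI simp: algebra_simps)
    then have "smooth_on ?I ?l"
      by (intro smooth_on_add smooth_on_const) auto
    then have smI: "smooth_on ?I ?\<gamma>"
      using lI by (intro smooth_on_compose[OF _ _ sm(2), of ?I ?l]) auto
    \<comment> \<open>On \<open>P\<close> the manifold topology is the Euclidean one, so Euclidean
      continuity becomes continuity into \<open>T\<close>.\<close>
    have "continuous_map (top_of_set ?I) (subtopology T P) ?\<gamma>"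
      unfolding P(3) using smooth_on_continuous_on[OF smI] \<gamma>P by auto
    then have "smooth_map (top_of_set ?I) T ?\<gamma>"
      unfolding smooth_map_def using smI
      by (auto simp: continuous_map_in_subtopology intro!: exI[of _ ?I] exI[of _ ?\<gamma>])
    moreover have "?\<gamma> 0 = p" using bij U(1) by (simp add: bij_betw_inv_into_left)
    moreover have "(?\<gamma> has_vector_derivative w) (at 0)"
    proof -
      have l: "(?l has_vector_derivative ?D w) (at 0)"
        by (auto intro!: derivative_eq_intros simp: has_vector_derivative_def)
      have "((?g \<circ> ?l) has_vector_derivative frechet_derivative ?g (at (\<Phi> p)) (?D w)) (at 0)"
        using vector_derivative_diff_chain_within[of ?l "?D w" 0 UNIV ?g "frechet_derivative ?g (at (\<Phi> p))"] l
          has_derivative_at_withinI[OF diffeomorphism_has_derivative_inverse(1)[OF U(2,1)]] by simp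
      then show ?thesis
        by (simp add: diffeomorphism_has_derivative_inverse(2)[OF U(2,1)] o_def)
    qed
    ultimately show ?thesis unfolding tangent_space_def using e(1) by blast
  qed
qed

lemma tangent_space_immersed_submanifold:
  fixes T :: "'a::euclidean_space topology"
  assumes "immersed_submanifold k T" "p \<in> topspace T"
  shows "subspace (tangent_space T p)" "dim (tangent_space T p) = k"
proof -
  obtain P where P: "openin T P" "p \<in> P" "embedded_submanifold k P" "subtopology T P = top_of_set P"
    using assms unfolding immersed_submanifold_def by blast
  obtain U V and \<Phi> :: "'a \<Rightarrow> 'a" and L where U: "p \<in> U" "diffeomorphism U V \<Phi>" and L: "subspace L" "dim L = k" "\<Phi> ` (U \<inter> P) = V \<inter> L"
    using P(2,3) unfolding embedded_submanifold_def by blast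
  let ?D = "frechet_derivative \<Phi> (at p)"
  note D = diffeomorphism_derivative[OF U(2,1)]
  have eq: "tangent_space T p = ?D -` L"
    using tangent_space_patch[OF P(1,2,4) U L(1,3)] by (simp add: vimage_def)
  show "subspace (tangent_space T p)"
    unfolding eq using D(2) L(1) by (rule linear_subspace_vimage)
  have "dim (?D ` tangent_space T p) = dim (tangent_space T p)"
    by (rule dim_image_eq[OF D(2)]) (use D(3) in \<open>auto intro: inj_on_subset\<close>)
  moreover have "?D ` tangent_space T p = L"
    unfolding eq using linear_inj_imp_surj[OF D(2,3)] by (simp add: surj_image_vimage_eq)
  ultimately show "dim (tangent_space T p) = k" using L(2) by simp
qed

section \<open>Embedded pieces and transversal preimages\<close>

lemma embedded_submanifold_Int_open:
  fixes S :: "'a::euclidean_space set"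
  assumes "embedded_submanifold k S" "open W"
  shows "embedded_submanifold k (S \<inter> W)"
  unfolding embedded_submanifold_def
proof
  fix p assume p: "p \<in> S \<inter> W"
  then obtain U V and \<Phi> :: "'a \<Rightarrow> 'a" and L where U: "p \<in> U" "diffeomorphism U V \<Phi>" and L: "subspace L" "dim L = k" "\<Phi> ` (U \<inter> S) = V \<inter> L"
    using assms(1) unfolding embedded_submanifold_def by blast
  have "diffeomorphism (U \<inter> W) (\<Phi> ` (U \<inter> W)) \<Phi>"
    using U(2) assms(2) by (intro diffeomorphism_restrict[OF U(2)]) (auto simp: diffeomorphism_def)
  moreover have "\<Phi> ` ((U \<inter> W) \<inter> (S \<inter> W)) = \<Phi> ` (U \<inter> W) \<inter> L"
  proof -
    have "inj_on \<Phi> U" using U(2) by (auto simp: diffeomorphism_def bij_betw_def)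
    then have "\<Phi> ` ((U \<inter> W) \<inter> (U \<inter> S)) = \<Phi> ` (U \<inter> W) \<inter> \<Phi> ` (U \<inter> S)"
      by (rule inj_on_image_Int) auto
    moreover have "\<Phi> ` (U \<inter> W) \<subseteq> V" using U(2) by (auto simp: diffeomorphism_def bij_betw_def)
    moreover have "(U \<inter> W) \<inter> (U \<inter> S) = (U \<inter> W) \<inter> (S \<inter> W)" by auto
    ultimately show ?thesis using L(3) by auto
  qed
  ultimately show "\<exists>U V (\<Phi> :: 'a \<Rightarrow> 'a) L. p \<in> U \<and> diffeomorphism U V \<Phi> \<and>
      subspace L \<and> dim L = k \<and> \<Phi> ` (U \<inter> (S \<inter> W)) = V \<inter> L"
    using p U L by blast
qed

lemma second_countable_euclidean:
  "second_countable (euclidean :: 'a::second_countable_topology topology)"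
proof -
  obtain B :: "'a set set" where B: "countable B" "topological_basis B"
    using ex_countable_basis by blast
  then show ?thesis
    unfolding second_countable_def
    by (intro exI[of _ B]) (auto simp: topological_basis_open elim: topological_basisE[OF B(2)])
qed

lemma embedded_submanifold_imp_immersed:
  assumes "embedded_submanifold k S"
  shows "immersed_submanifold k (top_of_set S)"
  unfolding immersed_submanifold_def
proof (intro conjI ballI)
  show "second_countable (top_of_set S)"
    by (rule second_countable_subtopology) (rule second_countable_euclidean)
  show "\<exists>P. openin (top_of_set S) P \<and> p \<in> P \<and> embedded_submanifold k P \<and> subtopology (top_of_set S) P = top_of_set P"
    if "p \<in> topspace (top_of_set S)" for p
    using assms that by (intro exI[of _ S]) (auto simp: subtopology_subtopology)
qed

text \<open>By Baire's theorem one of countably many compact pieces of patches has interior points in the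
  ambient topology.\<close>

lemma immersed_submanifold_embedded_somewhere:
  fixes T :: "'a::euclidean_space topology"
  assumes T: "immersed_submanifold k T" "topspace T \<noteq> {}"
    and cm: "completely_metrizable_space (top_of_set (topspace T))"
  obtains W where "open W" "topspace T \<inter> W \<noteq> {}" "embedded_submanifold k (topspace T \<inter> W)"
proof -
  let ?S = "topspace T"
  have "\<exists>Q K P. openin T Q \<and> p \<in> Q \<and> Q \<subseteq> K \<and> compact K \<and> K \<subseteq> P \<and> P \<subseteq> ?S \<and> embedded_submanifold k P"
    if p: "p \<in> ?S" for p
  proof -
    obtain P where P: "openin T P" "p \<in> P" "embedded_submanifold k P" "subtopology T P = top_of_set P"
      using T(1) p unfolding immersed_submanifold_def by blast
    obtain U V and \<Phi> :: "'a \<Rightarrow> 'a" and L where U: "p \<in> U" "diffeomorphism U V \<Phi>" and L: "subspace L" "dim L = k" "\<Phi> ` (U \<inter> P) = V \<inter> L"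
      using P(2,3) unfolding embedded_submanifold_def by blast
    have opn: "open U" "open V" and bij: "bij_betw \<Phi> U V"
      and cont: "continuous_on U \<Phi>" "continuous_on V (inv_into U \<Phi>)"
      using U(2) smooth_on_continuous_on by (auto simp: diffeomorphism_def)
    have "\<Phi> p \<in> V" using bij U(1) by (auto simp: bij_betw_def)
    then obtain r where r: "r > 0" "cball (\<Phi> p) r \<subseteq> V"
      using opn(2) open_contains_cball by blast
    \<comment> \<open>\<open>K\<close> is compact, hence closed in the ambient topology as Baire's
      theorem demands; \<open>Q\<close> lies inside it and is open in \<open>T\<close>, so that the
      sets \<open>Q\<close> admit a countable subcover.\<close>
    define K where "K = inv_into U \<Phi> ` (cball (\<Phi> p) r \<inter> L)"
    define Q where "Q = P \<inter> (U \<inter> \<Phi> -` ball (\<Phi> p) r)"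
    have "open (U \<inter> \<Phi> -` ball (\<Phi> p) r)"
      using cont(1) opn(1) open_ball by (rule continuous_open_preimage)
    then have "openin (subtopology T P) Q"
      unfolding P(4) Q_def by (auto simp: openin_open)
    then have "openin T Q" using P(1) by (metis openin_trans_full)
    moreover have "p \<in> Q" using U(1) P(2) r by (simp add: Q_def)
    moreover have "Q \<subseteq> K"
    proof
      fix x assume x: "x \<in> Q"
      then have "\<Phi> x \<in> cball (\<Phi> p) r \<inter> L" using L(3) by (auto simp: Q_def less_imp_le)
      moreover have "x = inv_into U \<Phi> (\<Phi> x)"
        using x bij by (simp add: Q_def bij_betw_inv_into_left)
      ultimately show "x \<in> K" unfolding K_def by blast
    qed
    moreover have "compact K"
      unfolding K_def
    proof (rule compact_continuous_image)
      show "continuous_on (cball (\<Phi> p) r \<inter> L) (inv_into U \<Phi>)"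
        using cont(2) r(2) by (auto intro: continuous_on_subset)
      show "compact (cball (\<Phi> p) r \<inter> L)"
        using L(1) by (intro compact_Int_closed closed_subspace compact_cball)
    qed
    moreover have "K \<subseteq> P"
    proof
      fix x assume "x \<in> K"
      then obtain y where y: "y \<in> cball (\<Phi> p) r \<inter> L" "x = inv_into U \<Phi> y" by (auto simp: K_def)
      then have "y \<in> \<Phi> ` (U \<inter> P)" using r(2) L(3) by auto
      then show "x \<in> P" using y(2) bij by (auto simp: bij_betw_inv_into_left)
    qed
    moreover have "P \<subseteq> ?S" using P(1) by (rule openin_subset)
    ultimately show ?thesis using P(3) by blast
  qed
  then obtain Q K P where QKP: "\<And>p. p \<in> ?S \<Longrightarrow> openin T (Q p) \<and> p \<in> Q p \<and> Q p \<subseteq> K p \<and>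
      compact (K p) \<and> K p \<subseteq> P p \<and> P p \<subseteq> ?S \<and> embedded_submanifold k (P p)"
    by metis
  have "Lindelof_space T"
    using T(1) by (auto simp: immersed_submanifold_def intro: second_countable_imp_Lindelof_space)
  then have "\<exists>\<V>. countable \<V> \<and> \<V> \<subseteq> Q ` ?S \<and> ?S \<subseteq> \<Union>\<V>"
    unfolding Lindelof_space_alt using QKP by (auto dest!: spec[of _ "Q ` ?S"])
  then obtain C where C: "countable C" "C \<subseteq> ?S" "?S \<subseteq> \<Union>(Q ` C)"
    by (metis countable_subset_image)
  have cover: "\<Union>(K ` C) = ?S"
  proof
    show "\<Union>(K ` C) \<subseteq> ?S" using C(2) QKP by (meson UN_least subset_iff subset_trans)
    have "\<Union>(Q ` C) \<subseteq> \<Union>(K ` C)" using C(2) QKP by (meson UN_mono order_refl subset_iff)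
    then show "?S \<subseteq> \<Union>(K ` C)" using C(3) by blast
  qed
  have "\<exists>p\<in>C. top_of_set ?S interior_of K p \<noteq> {}"
  proof (rule ccontr)
    assume neg: "\<not> ?thesis"
    have "top_of_set ?S interior_of \<Union>(K ` C) = {}"
    proof (rule Baire_category_alt)
      show "completely_metrizable_space (top_of_set ?S) \<or>
          locally_compact_space (top_of_set ?S) \<and> regular_space (top_of_set ?S)"
        using cm by simp
      show "countable (K ` C)" using C(1) by simp
      fix X assume "X \<in> K ` C"
      then obtain p where p: "p \<in> C" "X = K p" by blast
      then have "closed X" "X \<subseteq> ?S" using QKP C(2) compact_imp_closed by (meson subset_iff)+
      then have "closedin (top_of_set ?S) X" by (simp add: closed_subset)
      then show "closedin (top_of_set ?S) X \<and> top_of_set ?S interior_of X = {}"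
        using neg p by auto
    qed
    then show False
      using T(2) by (simp add: cover interior_of_openin)
  qed
  then obtain p x where p: "p \<in> C" and "x \<in> top_of_set ?S interior_of K p" by blast
  then obtain X where X: "openin (top_of_set ?S) X" "x \<in> X" "X \<subseteq> K p"
    by (auto simp: interior_of_def)
  then obtain W where W: "open W" "X = ?S \<inter> W" by (auto simp: openin_open)
  \<comment> \<open>Inside \<open>W\<close> all of \<open>?S\<close> lies in the compact piece
    \<open>K p\<close> of the patch \<open>P p\<close>, so the two sets coincide there.\<close>
  have "?S \<inter> W = P p \<inter> W"
    using W X QKP[of p] p C(2) by blast
  moreover have "embedded_submanifold k (P p \<inter> W)"
    using QKP[of p] p C(2) W(1) by (intro embedded_submanifold_Int_open) auto
  ultimately show thesis using W X by (intro that[of W]) auto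
qed

text \<open>The implicit function theorem at a point: the preimage of a submanifold under a map transversal
  to it at \<open>z0\<close> is straightened near \<open>z0\<close> by a map whose derivative at \<open>z0\<close> is the identity.\<close>

lemma embedded_submanifold_transversal_preimage:
  fixes f :: "'b::euclidean_space \<Rightarrow> 'c::euclidean_space"
  assumes S: "embedded_submanifold k S" and f: "smooth_on UNIV f" "f z0 \<in> S"
    and trans: "\<And>w. \<exists>v. \<exists>t\<in>tangent_space (top_of_set S) (f z0). w = frechet_derivative f (at z0) v + t"
  obtains U V and \<Psi> :: "'b \<Rightarrow> 'b" and E where "z0 \<in> U" "diffeomorphism U V \<Psi>" "subspace E"
    "dim E + DIM('c) = DIM('b) + k" "\<Psi> ` (U \<inter> f -` S) = V \<inter> E"
proof -
  obtain U0 V0 and \<Phi> :: "'c \<Rightarrow> 'c" and L where U0: "f z0 \<in> U0" "diffeomorphism U0 V0 \<Phi>"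
    and L: "subspace L" "dim L = k" "\<Phi> ` (U0 \<inter> S) = V0 \<inter> L"
    using S f(2) unfolding embedded_submanifold_def by blast
  let ?D = "frechet_derivative \<Phi> (at (f z0))" and ?F = "frechet_derivative f (at z0)"
  note D = diffeomorphism_derivative[OF U0(2,1)]
  have tan: "tangent_space (top_of_set S) (f z0) = {w. ?D w \<in> L}"
    by (rule tangent_space_patch[OF _ f(2) _ U0 L(1,3)]) (auto simp: subtopology_subtopology)
  have opn: "open U0" and bij: "bij_betw \<Phi> U0 V0" and sm\<Phi>: "smooth_on U0 \<Phi>"
    using U0(2) by (auto simp: diffeomorphism_def)
  obtain q :: "'c \<Rightarrow> 'c" where q: "linear q" "\<And>x. q x = 0 \<longleftrightarrow> x \<in> L"
    using exists_linear_kernel_eq_subspace[OF L(1)] by blast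
  \<comment> \<open>\<open>h z = 0\<close> is the local equation of the preimage, as
    \<open>q\<close> vanishes exactly on \<open>L\<close>; \<open>h'\<close> is the derivative of
    \<open>h\<close> at \<open>z0\<close>.\<close>
  define h where "h z = q (\<Phi> (f z))" for z
  define h' where "h' v = q (?D (?F v))" for v
  have derf: "(f has_derivative ?F) (at z0)"
    using f(1) by (rule smooth_on_has_derivative) simp
  have linh': "linear h'"
    unfolding h'_def using linear_compose[OF linear_compose[OF has_derivative_linear[OF derf] D(2)] q(1)]
    by (simp add: o_def)
  have derh: "(h has_derivative h') (at z0)"
    unfolding h_def h'_def
    by (rule bounded_linear.has_derivative[OF linear_conv_bounded_linear[THEN iffD1, OF q(1)]
          has_derivative_compose[OF derf D(1)]])
  \<comment> \<open>\<open>q\<close> annihilates the image of the tangent space of \<open>S\<close>;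
    by transversality the remaining directions, coming from \<open>f\<close>, already fill the range
    of \<open>q\<close>.\<close>
  have range_h': "range h' = range q"
  proof
    show "range h' \<subseteq> range q" by (auto simp: h'_def)
    show "range q \<subseteq> range h'"
    proof clarify
      fix y
      obtain w where w: "y = ?D w"
        using linear_inj_imp_surj[OF D(2,3)] by (metis surjD)
      obtain v t where v: "?D t \<in> L" "w = ?F v + t" using trans[of w] tan by auto
      then have "q y = h' v"
        using q(2)[of "?D t"] by (simp add: w h'_def linear_add[OF D(2)] linear_add[OF q(1)])
      then show "q y \<in> range h'" by blast
    qed
  qed
  define E where "E = {v. h' v = 0}"
  have E: "subspace E" unfolding E_def using linh' by (rule linear_subspace_kernel)
  \<comment> \<open>Rank-nullity for \<open>h'\<close> and for \<open>q\<close>, which have the same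
    range.\<close>
  have dimE: "dim E + DIM('c) = DIM('b) + k"
    using dim_kernel_plus_dim_range[OF linh'] dim_kernel_plus_dim_range[OF q(1)] L(2)
    by (simp add: E_def range_h' q(2))
  obtain s :: "'c \<Rightarrow> 'b" where s: "linear s" "\<And>v. v \<in> range h' \<Longrightarrow> h' (s v) = v"
    using linear_exists_right_inverse_on[OF linh' subspace_UNIV] by blast
  \<comment> \<open>Exchanging the linear part \<open>h' z\<close> for \<open>h z\<close> along the
    right inverse \<open>s\<close> gives \<open>h' (\<Psi> z) = h z\<close>, so zeros of
    \<open>h\<close> correspond to the kernel \<open>E\<close>. The two corrections cancel in the
    derivative at \<open>z0\<close>.\<close>
  define \<Psi> where "\<Psi> z = z + (s (h z) - s (h' z))" for z
  define W where "W = f -` U0"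
  have W: "open W" "z0 \<in> W"
    using smooth_on_continuous_on[OF f(1)] opn U0(1) by (auto simp: W_def continuous_on_open_vimage)
  have smh: "smooth_on W h"
    unfolding h_def
    by (intro smooth_on_bounded_linear_comp[of q] smooth_on_compose[OF W(1) smooth_on_subset[OF f(1)] sm\<Phi>] W)
      (use q(1) in \<open>auto simp: W_def linear_conv_bounded_linear\<close>)
  have "smooth_on W (\<lambda>z. s (h z))"
    using smooth_on_bounded_linear_comp[OF _ W(1) smh, of s] s(1) by (simp add: linear_conv_bounded_linear)
  moreover have "linear (\<lambda>z. z - s (h' z))"
    using linear_compose_sub[OF linear_id linear_compose[OF linh' s(1)]] by (simp add: o_def id_def)
  then have "smooth_on W (\<lambda>z. z - s (h' z))" using W(1) by (rule smooth_on_linear)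
  ultimately have sm\<Psi>: "smooth_on W \<Psi>"
    unfolding \<Psi>_def using smooth_on_add[OF W(1)] by (fastforce simp: algebra_simps)
  have "(\<Psi> has_derivative (\<lambda>v. v + (s (h' v) - s (h' v)))) (at z0)"
    unfolding \<Psi>_def
    by (intro has_derivative_add has_derivative_diff has_derivative_ident
        bounded_linear.has_derivative[OF linear_conv_bounded_linear[THEN iffD1, OF s(1)]]
        derh linear_imp_has_derivative[OF linh'])
  then have "frechet_derivative \<Psi> (at z0) = (\<lambda>v. v)"
    using frechet_derivative_at by fastforce
  then have "inj (frechet_derivative \<Psi> (at z0))" by simp
  then obtain U where U: "open U" "z0 \<in> U" "U \<subseteq> W" "diffeomorphism U (\<Psi> ` U) \<Psi>"
    using smooth_local_diffeomorphism[OF W(1) sm\<Psi> W(2)] by blast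
  have mem: "f z \<in> S \<longleftrightarrow> \<Psi> z \<in> E" if "z \<in> U" for z
  proof -
    have fz: "f z \<in> U0" using that U(3) by (auto simp: W_def)
    have "h z \<in> range h'" unfolding range_h' h_def by blast
    then have "h' (\<Psi> z) = h z"
      using s(2)[of "h z"] s(2)[of "h' z"]
      by (simp add: \<Psi>_def linear_add[OF linh'] linear_diff[OF linh'])
    then have "\<Psi> z \<in> E \<longleftrightarrow> \<Phi> (f z) \<in> L" by (simp add: E_def h_def q(2))
    also have "\<dots> \<longleftrightarrow> \<Phi> (f z) \<in> \<Phi> ` (U0 \<inter> S)"
      using fz bij L(3) by (auto simp: bij_betw_def)
    also have "\<dots> \<longleftrightarrow> f z \<in> S"
      using fz bij by (auto simp: bij_betw_def dest: inj_onD)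
    finally show ?thesis by simp
  qed
  have "\<Psi> ` (U \<inter> f -` S) = \<Psi> ` U \<inter> E"
    using mem by auto
  then show thesis using U(2,4) E dimE by (intro that[of U "\<Psi> ` U" \<Psi> E])
qed

subsection \<open>Matrices and jets\<close>

abbreviation GL :: "(real^'n^'n) set" where
  "GL \<equiv> {A. invertible A}"

abbreviation jacobian :: "(real^'n \<Rightarrow> real^'n) \<Rightarrow> real^'n \<Rightarrow> real^'n^'n" where
  "jacobian f x \<equiv> matrix (frechet_derivative f (at x))"

lemma matrix_inv_cancel:
  fixes A :: "real^'n^'n"
  assumes "invertible A"
  shows "A ** matrix_inv A = mat 1" "matrix_inv A ** A = mat 1"
  using someI_ex[OF assms[unfolded invertible_def]] by (simp_all add: matrix_inv_def)

lemma matrix_inv_eq: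
  fixes A C :: "real^'n^'n"
  assumes "C ** A = mat 1"
  shows "matrix_inv A = C"
proof -
  have "invertible A" using assms invertible_left_inverse by blast
  then show ?thesis
    by (metis assms matrix_inv_cancel(1) matrix_mul_assoc matrix_mul_lid matrix_mul_rid)
qed

lemma invertible_matrix_inv:
  fixes A :: "real^'n^'n"
  shows "invertible A \<Longrightarrow> invertible (matrix_inv A)"
  using matrix_inv_cancel invertible_def by blast

lemma invertible_mat_1: "invertible (mat 1 :: real^'n^'n)"
  unfolding invertible_def by (rule exI[of _ "mat 1"]) simp

lemma matrix_mult_inv_cancel:
  fixes A C :: "real^'n^'n"
  assumes "invertible A"
  shows "C ** A ** matrix_inv A = C" "C ** matrix_inv A ** A = C"
    "A ** (matrix_inv A ** C) = C" "matrix_inv A ** (A ** C) = C"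
  using matrix_inv_cancel[OF assms] by (simp_all add: matrix_mul_assoc) (simp_all add: matrix_mul_assoc[symmetric])

lemma bounded_bilinear_matrix_mult:
  "bounded_bilinear ((**) :: real^'n^'m \<Rightarrow> real^'p^'n \<Rightarrow> real^'p^'m)"
proof -
  have "bilinear ((**) :: real^'n^'m \<Rightarrow> real^'p^'n \<Rightarrow> real^'p^'m)"
    unfolding bilinear_def
    by (auto intro!: linearI simp: matrix_matrix_mult_def vec_eq_iff sum_distrib_left algebra_simps
        sum.distrib)
  then show ?thesis by (simp add: bilinear_conv_bounded_bilinear)
qed

lemma smooth_on_matrix_mult:
  fixes f :: "'a::euclidean_space \<Rightarrow> real^'n^'m" and g :: "'a \<Rightarrow> real^'p^'n"
  shows "open S \<Longrightarrow> smooth_on S f \<Longrightarrow> smooth_on S g \<Longrightarrow> smooth_on S (\<lambda>x. f x ** g x)"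
  by (rule smooth_on_bounded_bilinear[OF bounded_bilinear_matrix_mult])

lemma open_GL: "open (GL :: (real^'n^'n) set)"
proof -
  have "continuous_on UNIV (det :: real^'n^'n \<Rightarrow> real)"
    unfolding det_def by (intro continuous_intros)
  then have "open (det -` (- {0 :: real}) :: (real^'n^'n) set)"
    by (intro open_vimage) auto
  moreover have "(det -` (- {0 :: real}) :: (real^'n^'n) set) = GL"
    by (auto simp: invertible_det_nz)
  ultimately show ?thesis by simp
qed

text \<open>\<open>matrix_inv A\<close> is the preimage of the unit matrix under left multiplication
  by \<open>A\<close>, a family of linear maps that itself depends linearly on
  \<open>A\<close>.\<close>

lemma smooth_on_matrix_inv: "smooth_on GL (matrix_inv :: real^'n^'n \<Rightarrow> real^'n^'n)"
proof -
  let ?L = "\<lambda>(A :: real^'n^'n) (X :: real^'n^'n). A ** X"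
  note bb = bounded_bilinear_matrix_mult
  have inj: "inj (?L A)" if "A \<in> GL" for A
    using that by (intro injI) (metis mem_Collect_eq matrix_mult_inv_cancel(4))
  have "Ck_on k GL (\<lambda>A. inv (?L A) (mat 1))" for k
  proof (rule Ck_on_inverse_linear_family[OF open_GL])
    show "linear (?L A)" for A
      using bounded_bilinear.bounded_linear_right[OF bb] by (rule bounded_linear.linear)
    show "Ck_on k GL (\<lambda>A. A ** X)" for X :: "real^'n^'n"
      using bounded_bilinear.bounded_linear_left[OF bb] open_GL by (rule Ck_on_bounded_linear)
  qed (rule inj)
  then have "smooth_on GL (\<lambda>A. inv (?L A) (mat 1))" by (simp add: smooth_on_def)
  then show ?thesis
  proof (rule smooth_on_cong[OF open_GL, rotated])
    fix A :: "real^'n^'n" assume A: "A \<in> GL"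
    have "inv (?L A) (?L A (matrix_inv A)) = matrix_inv A"
      using inj[OF A] by (rule inv_f_f)
    then show "inv (?L A) (mat 1) = matrix_inv A"
      using A matrix_inv_cancel(1) by (metis mem_Collect_eq)
  qed
qed

lemma smooth_on_vec_lambda:
  fixes f :: "'n::finite \<Rightarrow> 'a::euclidean_space \<Rightarrow> 'b::euclidean_space"
  assumes "open S" "\<And>i. smooth_on S (f i)"
  shows "smooth_on S (\<lambda>x. \<chi> i. f i x)"
proof -
  let ?e = "\<lambda>i v. (\<chi> k. if k = i then v else 0) :: 'b^'n"
  have bl: "bounded_linear (?e i)" for i
    unfolding linear_conv_bounded_linear[symmetric] by (auto intro!: linearI simp: vec_eq_iff)
  have "smooth_on S (\<lambda>x. ?e i (f i x))" for i
    by (rule smooth_on_bounded_linear_comp[OF bl assms])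
  then have "smooth_on S (\<lambda>x. \<Sum>i\<in>UNIV. ?e i (f i x))"
    by (rule smooth_on_sum[OF assms(1)])
  moreover have "(\<Sum>i\<in>UNIV. ?e i (f i x)) = (\<chi> i. f i x)" for x
    by (simp add: vec_eq_iff sum.delta)
  ultimately show ?thesis by simp
qed

lemma smooth_on_jacobian:
  assumes "open S" "smooth_on S f"
  shows "smooth_on S (jacobian f)"
  unfolding matrix_def
  by (rule smooth_on_vec_lambda[OF assms(1) smooth_on_vec_lambda[OF assms(1)
        smooth_on_bounded_linear_comp[OF bounded_linear_vec_nth assms(1) smooth_on_frechet_derivative[OF assms(2)]]]])

lemma jacobian_eqI:
  assumes "(f has_derivative (*v) A) (at x)"
  shows "jacobian f x = A"
  using frechet_derivative_at[OF assms] by (metis matrix_of_matrix_vector_mul)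

lemma jacobian_has_derivative:
  assumes "smooth_on S f" "x \<in> S"
  shows "(f has_derivative (*v) (jacobian f x)) (at x)"
  using smooth_on_has_derivative[OF assms] has_derivative_linear by (metis matrix_vector_mul(2))

lemma invertible_jacobian:
  assumes "diffeomorphism U V f" "x \<in> U"
  shows "invertible (jacobian f x)"
proof -
  have "inj ((*v) (jacobian f x))"
    using diffeomorphism_derivative[OF assms] by simp
  then show ?thesis
    using matrix_left_invertible_injective invertible_left_inverse by (metis inj_def)
qed

lemma diffeomorphism_jacobian_inverse:
  assumes "diffeomorphism U V f" "x \<in> U"
  shows "(inv_into U f has_derivative (*v) (matrix_inv (jacobian f x))) (at (f x))"
proof -
  let ?G = "frechet_derivative (inv_into U f) (at (f x))"
  note g = diffeomorphism_has_derivative_inverse[OF assms]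
  have "matrix ?G ** jacobian f x = matrix (?G \<circ> frechet_derivative f (at x))"
    by (rule matrix_compose[symmetric])
      (use diffeomorphism_derivative[OF assms] has_derivative_linear[OF g(1)] in auto)
  also have "?G \<circ> frechet_derivative f (at x) = id" using g(2) by auto
  finally have "matrix_inv (jacobian f x) = matrix ?G"
    by (intro matrix_inv_eq) (simp only: matrix_id_mat_1)
  moreover have "(*v) (matrix ?G) = ?G"
    using has_derivative_linear[OF g(1)] by simp
  ultimately show ?thesis using g(1) by simp
qed

section \<open>Jets, deformations and material isomorphisms as matrices\<close>

lemma affine_has_derivative: "((\<lambda>z. y + F *v (z - x)) has_derivative (*v) F) (at z)" for F :: "real^'n^'n"
proof -
  have "((\<lambda>z. y + (F *v z - F *v x)) has_derivative (\<lambda>h. 0 + (F *v h - 0))) (at z)"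
    by (intro has_derivative_add has_derivative_const has_derivative_diff
        bounded_linear_imp_has_derivative matrix_vector_mul_bounded_linear)
  then show ?thesis by (simp add: matrix_vector_mult_diff_distrib)
qed

lemma smooth_on_affine:
  fixes F :: "real^'n^'n"
  assumes "open S"
  shows "smooth_on S (\<lambda>z. y + F *v (z - x))"
proof -
  have "smooth_on S (\<lambda>z. (y - F *v x) + F *v z)"
    using assms by (intro smooth_on_add smooth_on_const smooth_on_bounded_linear) auto
  then show ?thesis by (simp add: matrix_vector_mult_diff_distrib algebra_simps)
qed

text \<open>A triple with invertible matrix is the jet of an affine map, restricted to those points
  of \<open>B\<close> that it sends into \<open>B\<close>.\<close>

lemma Pi1_eq:
  fixes B :: "(real^'n) set"
  assumes "open B"
  shows "Pi1 B B = B \<times> B \<times> GL"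
proof
  show "Pi1 B B \<subseteq> B \<times> B \<times> GL"
  proof
    fix j assume "j \<in> Pi1 B B"
    then obtain \<phi> x U V where j: "j = jet1 \<phi> x" "x \<in> U" "U \<subseteq> B" "V \<subseteq> B" "diffeomorphism U V \<phi>"
      unfolding Pi1_def local_diffeo_at_def by blast
    then have "\<phi> x \<in> V" by (auto simp: diffeomorphism_def bij_betw_def)
    then show "j \<in> B \<times> B \<times> GL"
      using j invertible_jacobian[of U V \<phi> x] by (auto simp: jet1_def)
  qed
  show "B \<times> B \<times> GL \<subseteq> Pi1 B B"
  proof clarify
    fix x y and F :: "real^'n^'n" assume x: "x \<in> B" "y \<in> B" "invertible F"
    let ?\<phi> = "\<lambda>z. y + F *v (z - x)"
    let ?U = "B \<inter> ?\<phi> -` B"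
    have der: "frechet_derivative ?\<phi> (at z) = (*v) F" for z
      using frechet_derivative_at[OF affine_has_derivative] by metis
    have "open ?U"
      using assms smooth_on_continuous_on[OF smooth_on_affine[OF open_UNIV]]
      by (intro open_Int open_vimage) auto
    moreover have "inj_on ?\<phi> ?U"
      by (auto intro!: inj_onI dest!: injD[OF inj_matrix_vector_mult[OF x(3)]])
    ultimately have "diffeomorphism ?U (?\<phi> ` ?U) ?\<phi>"
      using inj_matrix_vector_mult[OF x(3)] by (intro diffeomorphism_image smooth_on_affine) (auto simp: der)
    then have "local_diffeo_at B B ?\<phi> x"
      unfolding local_diffeo_at_def using x by (intro exI[of _ ?U] exI[of _ "?\<phi> ` ?U"]) auto
    moreover have "(x, y, F) = jet1 ?\<phi> x"
      by (simp add: jet1_def der)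
    ultimately show "(x, y, F) \<in> Pi1 B B" unfolding Pi1_def by blast
  qed
qed

text \<open>A translation has the unit matrix as Jacobian: it moves the target and leaves the matrix
  alone. The extended response thus depends on source and matrix only.\<close>

lemma response_ext_jet:
  "response_ext W (x, y, F) = W (x, x, F)"
proof -
  have "((\<lambda>z. z + (x - y)) has_derivative (*v) (mat 1)) (at y)"
    by (auto intro!: derivative_eq_intros simp: fun_eq_iff)
  from jacobian_eqI[OF this] show ?thesis
    by (simp add: response_ext_def jet1_def jcomp_def jsrc_def jtgt_def jlin_def)
qed

text \<open>In equal dimensions an embedding has open image and smooth inverse, by
  \<open>diffeomorphism_image\<close>.\<close>

lemma deformation_iff_diffeomorphism:
  assumes "open B"
  shows "deformation B \<kappa> \<longleftrightarrow> diffeomorphism B (\<kappa> ` B) \<kappa>"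
proof
  assume def: "deformation B \<kappa>"
  then obtain g where "homeomorphism B (\<kappa> ` B) \<kappa> g" by (auto simp: deformation_def)
  then have "inj_on \<kappa> B" unfolding homeomorphism_def by (metis inj_on_inverseI)
  then show "diffeomorphism B (\<kappa> ` B) \<kappa>"
    by (rule diffeomorphism_image[OF assms, rotated]) (use def in \<open>auto simp: deformation_def\<close>)
next
  assume d: "diffeomorphism B (\<kappa> ` B) \<kappa>"
  then have "homeomorphism B (\<kappa> ` B) \<kappa> (inv_into B \<kappa>)"
    using smooth_on_continuous_on
    by (fastforce simp: diffeomorphism_def bij_betw_def homeomorphism_def f_inv_into_f inv_into_into image_iff)
  then show "deformation B \<kappa>"
    using d diffeomorphism_derivative(3)[OF d] by (auto simp: deformation_def diffeomorphism_def)
qed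

text \<open>A deformation enters the material equation only through its Jacobian at
  \<open>Y\<close>, and each invertible \<open>F\<close> is the Jacobian of a linear
  deformation.\<close>

lemma material_groupoid_iff:
  assumes "open B"
  shows "(X, Y, P) \<in> material_groupoid B W \<longleftrightarrow>
    X \<in> B \<and> Y \<in> B \<and> invertible P \<and> (\<forall>F. invertible F \<longrightarrow> W (X, X, F ** P) = W (Y, Y, F))"
proof -
  have resp: "response_ext W (jet1 \<kappa> Y \<odot> (X, Y, P)) = W (X, X, jacobian \<kappa> Y ** P)"
    "response_ext W (jet1 \<kappa> Y) = W (Y, Y, jacobian \<kappa> Y)" for \<kappa>
    by (simp_all add: jet1_def jcomp_def jsrc_def jtgt_def jlin_def response_ext_jet)
  have "(\<forall>\<kappa>. deformation B \<kappa> \<longrightarrow> W (X, X, jacobian \<kappa> Y ** P) = W (Y, Y, jacobian \<kappa> Y)) \<longleftrightarrow>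
    (\<forall>F. invertible F \<longrightarrow> W (X, X, F ** P) = W (Y, Y, F))" (is "?l \<longleftrightarrow> ?r") if Y: "Y \<in> B"
  proof
    assume l: ?l
    show ?r
    proof (intro allI impI)
      fix F :: "real^3^3" assume F: "invertible F"
      let ?\<kappa> = "(*v) F"
      have der: "frechet_derivative ?\<kappa> (at z) = (*v) F" for z
        using frechet_derivative_at[OF bounded_linear_imp_has_derivative[OF matrix_vector_mul_bounded_linear]]
        by metis
      have "diffeomorphism B (?\<kappa> ` B) ?\<kappa>"
        using inj_matrix_vector_mult[OF F]
        by (intro diffeomorphism_image smooth_on_bounded_linear assms) (auto simp: der intro: inj_on_subset)
      then have "deformation B ?\<kappa>" using deformation_iff_diffeomorphism[OF assms] by blast
      with l have "W (X, X, jacobian ?\<kappa> Y ** P) = W (Y, Y, jacobian ?\<kappa> Y)" by blast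
      then show "W (X, X, F ** P) = W (Y, Y, F)" by (simp add: der)
    qed
  next
    assume ?r
    then show ?l
      using deformation_iff_diffeomorphism[OF assms] invertible_jacobian Y by blast
  qed
  then show ?thesis
    by (auto simp: material_groupoid_def Pi1_eq[OF assms] resp[unfolded jtgt_def] jtgt_def)
qed

text \<open>By the chain rule, in which the translation contributes the unit matrix, homogeneity
  becomes a condition on Jacobians of \<open>\<kappa>\<close>.\<close>

lemma jet1_translation_conjugate:
  assumes d: "diffeomorphism U V \<kappa>" and X: "X \<in> U" "Y \<in> U"
  shows "jet1 (inv_into U \<kappa> \<circ> translate (\<kappa> Y - \<kappa> X) \<circ> \<kappa>) X
    = (X, Y, matrix_inv (jacobian \<kappa> Y) ** jacobian \<kappa> X)"
proof -
  let ?f = "inv_into U \<kappa> \<circ> translate (\<kappa> Y - \<kappa> X) \<circ> \<kappa>"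
  have dk: "(\<kappa> has_derivative (*v) (jacobian \<kappa> X)) (at X)"
    using d X(1) jacobian_has_derivative by (auto simp: diffeomorphism_def)
  have 1: "((\<lambda>x. \<kappa> x + (\<kappa> Y - \<kappa> X)) has_derivative (*v) (jacobian \<kappa> X)) (at X)"
    using has_derivative_add[OF dk has_derivative_const[of "\<kappa> Y - \<kappa> X"]] by simp
  have "((\<lambda>x. inv_into U \<kappa> (\<kappa> x + (\<kappa> Y - \<kappa> X))) has_derivative
      (\<lambda>h. matrix_inv (jacobian \<kappa> Y) *v (jacobian \<kappa> X *v h))) (at X)"
    by (rule has_derivative_compose[OF 1]) (use diffeomorphism_jacobian_inverse[OF d X(2)] in simp)
  then have "(?f has_derivative (*v) (matrix_inv (jacobian \<kappa> Y) ** jacobian \<kappa> X)) (at X)"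
    by (simp add: o_def matrix_vector_mul_assoc)
  moreover have "?f X = Y"
    using d X by (auto simp: diffeomorphism_def bij_betw_inv_into_left)
  ultimately show ?thesis by (simp add: jet1_def jacobian_eqI)
qed

section \<open>Induced coordinates on jets and on the algebroid\<close>

lemma jet_coords_eq:
  "jet_coords \<phi> (x, y, P) = (\<phi> x, \<phi> y, jacobian \<phi> y ** P ** matrix_inv (jacobian \<phi> x))"
  by (simp add: jet_coords_def jet1_def jcomp_def jinv_def jsrc_def jtgt_def jlin_def)

lemma jid_eq: "jid x = (x, x, mat 1)"
proof -
  have "(id has_derivative (*v) (mat 1)) (at x)" for x :: "real^'n"
    by (auto intro!: derivative_eq_intros simp: fun_eq_iff id_def)
  from jacobian_eqI[OF this] show ?thesis by (simp add: jid_def jet1_def)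
qed

lemma smooth_on_jet_coords:
  assumes d: "diffeomorphism U V \<phi>"
  shows "smooth_on (U \<times> U \<times> GL) (jet_coords \<phi>)"
proof -
  have opn: "open U" and sm: "smooth_on U \<phi>" using d by (auto simp: diffeomorphism_def)
  let ?J = "U \<times> U \<times> (GL :: (real^'n^'n) set)"
  have J: "open ?J" using opn open_GL by (intro open_Times)
  have p1: "smooth_on ?J (\<lambda>j. fst j)" and p2: "smooth_on ?J (\<lambda>j. fst (snd j))"
    and p3: "smooth_on ?J (\<lambda>j. snd (snd j))"
    by (intro smooth_on_bounded_linear J bounded_linear_fst bounded_linear_snd
        bounded_linear_compose[OF bounded_linear_fst] bounded_linear_compose[OF bounded_linear_snd])+
  note jac = smooth_on_jacobian[OF opn sm]
  have "smooth_on ?J (\<lambda>j. jacobian \<phi> (fst j))"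
    by (rule smooth_on_compose[OF J p1 jac]) auto
  then have i: "smooth_on ?J (\<lambda>j. matrix_inv (jacobian \<phi> (fst j)))"
    by (rule smooth_on_compose[OF J _ smooth_on_matrix_inv]) (auto intro: invertible_jacobian[OF d])
  have 1: "smooth_on ?J (\<lambda>j. \<phi> (fst j))"
    by (rule smooth_on_compose[OF J p1 sm]) auto
  have 2: "smooth_on ?J (\<lambda>j. \<phi> (fst (snd j)))"
    by (rule smooth_on_compose[OF J p2 sm]) auto
  have 3: "smooth_on ?J (\<lambda>j. jacobian \<phi> (fst (snd j)))"
    by (rule smooth_on_compose[OF J p2 jac]) auto
  have "smooth_on ?J (\<lambda>j. (\<phi> (fst j), \<phi> (fst (snd j)),
      jacobian \<phi> (fst (snd j)) ** snd (snd j) ** matrix_inv (jacobian \<phi> (fst j))))"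
    by (intro smooth_on_Pair smooth_on_matrix_mult J 1 2 3 i p3)
  moreover have "jet_coords \<phi> = (\<lambda>j. (\<phi> (fst j), \<phi> (fst (snd j)),
      jacobian \<phi> (fst (snd j)) ** snd (snd j) ** matrix_inv (jacobian \<phi> (fst j))))"
    by (simp add: fun_eq_iff jet_coords_eq)
  ultimately show ?thesis by simp
qed

lemma frechet_derivative_jtgt: "frechet_derivative jtgt (at j) w = jtgt w"
proof -
  have "(jtgt has_derivative jtgt) (at j)"
    unfolding jtgt_def
    by (intro bounded_linear_imp_has_derivative bounded_linear_compose[OF bounded_linear_fst] bounded_linear_snd)
  from frechet_derivative_at[OF this] show ?thesis by simp
qed

text \<open>Source and target coordinates depend on source and target alone, which determines the
  first two components of \<open>D\<close>. A vector killed by \<open>D\<close> therefore has only a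
  matrix part, and on matrix parts \<open>D\<close> is conjugation by the Jacobian.\<close>

lemma jet_coords_derivative:
  assumes d: "diffeomorphism U V \<phi>" and x: "x \<in> U"
  defines "D \<equiv> frechet_derivative (jet_coords \<phi>) (at (jid x))"
  shows "(jet_coords \<phi> has_derivative D) (at (jid x))"
    and "jsrc (D w) = frechet_derivative \<phi> (at x) (jsrc w)"
    and "jtgt (D w) = frechet_derivative \<phi> (at x) (jtgt w)"
    and "inj D"
proof -
  have jx: "jid x \<in> U \<times> U \<times> GL" using x by (simp add: jid_eq invertible_mat_1)
  show der: "(jet_coords \<phi> has_derivative D) (at (jid x))"
    unfolding D_def using smooth_on_jet_coords[OF d] jx by (rule smooth_on_has_derivative)
  note d\<phi> = diffeomorphism_derivative[OF d x]
  have "((\<lambda>j. fst (jet_coords \<phi> j)) has_derivative (\<lambda>w. fst (D w))) (at (jid x))"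
    using der by (rule has_derivative_fst)
  moreover have "((\<lambda>j. fst (jet_coords \<phi> j)) has_derivative (\<lambda>w. frechet_derivative \<phi> (at x) (fst w))) (at (jid x))"
  proof -
    have "((\<lambda>j. \<phi> (fst j)) has_derivative (\<lambda>w. frechet_derivative \<phi> (at x) (fst w))) (at (jid x))"
      by (rule has_derivative_compose[OF has_derivative_fst[OF has_derivative_ident]]) (simp add: jid_eq d\<phi>(1))
    moreover have "(\<lambda>j. fst (jet_coords \<phi> j)) = (\<lambda>j. \<phi> (fst j))"
      by (auto simp: fun_eq_iff jet_coords_eq)
    ultimately show ?thesis by simp
  qed
  ultimately have src: "(\<lambda>w. fst (D w)) = (\<lambda>w. frechet_derivative \<phi> (at x) (fst w))"
    by (rule has_derivative_unique)
  then show src': "jsrc (D w) = frechet_derivative \<phi> (at x) (jsrc w)" for w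
    unfolding jsrc_def by meson
  have "((\<lambda>j. fst (snd (jet_coords \<phi> j))) has_derivative (\<lambda>w. fst (snd (D w)))) (at (jid x))"
    using der by (intro has_derivative_fst has_derivative_snd)
  moreover have "((\<lambda>j. fst (snd (jet_coords \<phi> j))) has_derivative (\<lambda>w. frechet_derivative \<phi> (at x) (fst (snd w)))) (at (jid x))"
  proof -
    have "((\<lambda>j. \<phi> (fst (snd j))) has_derivative (\<lambda>w. frechet_derivative \<phi> (at x) (fst (snd w)))) (at (jid x))"
      by (rule has_derivative_compose[OF has_derivative_fst[OF has_derivative_snd[OF has_derivative_ident]]])
        (simp add: jid_eq d\<phi>(1))
    moreover have "(\<lambda>j. fst (snd (jet_coords \<phi> j))) = (\<lambda>j. \<phi> (fst (snd j)))"
      by (auto simp: fun_eq_iff jet_coords_eq)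
    ultimately show ?thesis by simp
  qed
  ultimately have tgt: "(\<lambda>w. fst (snd (D w))) = (\<lambda>w. frechet_derivative \<phi> (at x) (fst (snd w)))"
    by (rule has_derivative_unique)
  then show tgt': "jtgt (D w) = frechet_derivative \<phi> (at x) (jtgt w)" for w
    unfolding jtgt_def by meson
  show "inj D"
    unfolding linear_injective_0[OF has_derivative_linear[OF der]]
  proof (intro allI impI)
    fix w assume w: "D w = 0"
    obtain a b C where abC: "w = (a, b, C)" by (metis prod.exhaust)
    have "frechet_derivative \<phi> (at x) a = 0" "frechet_derivative \<phi> (at x) b = 0"
      using src'[of w] tgt'[of w] w by (simp_all add: abC jsrc_def jtgt_def)
    then have ab: "a = 0" "b = 0"
      using d\<phi>(2,3) linear_injective_0 by blast+
    let ?J = "jacobian \<phi> x"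
    have J: "invertible ?J" using d x by (rule invertible_jacobian)
    \<comment> \<open>A straight line of matrices through the unit serves to evaluate
      \<open>D\<close> on the vertical vector \<open>(0, 0, C)\<close>.\<close>
    have "((\<lambda>t::real. (x, x, mat 1 + t *\<^sub>R C)) has_vector_derivative (0, 0, C)) (at 0)"
      by (auto intro!: derivative_eq_intros simp: has_vector_derivative_def fun_eq_iff)
    then have "((jet_coords \<phi> \<circ> (\<lambda>t::real. (x, x, mat 1 + t *\<^sub>R C))) has_vector_derivative D (0, 0, C)) (at 0)"
      using vector_derivative_diff_chain_within[of _ "(0,0,C)" 0 UNIV "jet_coords \<phi>" D]
        has_derivative_at_withinI[OF der] by (simp add: jid_eq)
    then have "((\<lambda>t. snd (snd ((jet_coords \<phi> \<circ> (\<lambda>t::real. (x, x, mat 1 + t *\<^sub>R C))) t)))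
        has_vector_derivative snd (snd (D (0, 0, C)))) (at 0)"
      by (intro bounded_linear.has_vector_derivative[OF bounded_linear_snd])
    then have "((\<lambda>t. ?J ** (mat 1 + t *\<^sub>R C) ** matrix_inv ?J) has_vector_derivative 0) (at 0)"
      using w by (simp add: jet_coords_eq o_def abC ab)
    moreover have "((\<lambda>t. ?J ** (mat 1 + t *\<^sub>R C) ** matrix_inv ?J) has_vector_derivative ?J ** C ** matrix_inv ?J) (at 0)"
    proof -
      note bb = bounded_bilinear_matrix_mult
      have "((\<lambda>t::real. mat 1 + t *\<^sub>R C) has_vector_derivative C) (at 0)"
        by (auto intro!: derivative_eq_intros simp: has_vector_derivative_def fun_eq_iff)
      then show ?thesis
        by (intro bounded_linear.has_vector_derivative[OF bounded_bilinear.bounded_linear_right[OF bb]]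
            bounded_linear.has_vector_derivative[OF bounded_bilinear.bounded_linear_left[OF bb]])
    qed
    ultimately have "?J ** C ** matrix_inv ?J = 0" by (rule vector_derivative_unique_at[symmetric])
    then have "matrix_inv ?J ** (?J ** C ** matrix_inv ?J ** ?J) = 0"
      by (simp add: matrix_matrix_mult_def vec_eq_iff)
    then have "C = 0" using J by (simp add: matrix_mult_inv_cancel)
    then show "w = 0" by (simp add: abC ab zero_prod_def)
  qed
qed

subsection \<open>From integrability to local homogeneity\<close>

lemma zero_mem_tangent_space:
  assumes "p \<in> topspace T"
  shows "0 \<in> tangent_space T p"
proof -
  have "smooth_map (top_of_set {-1<..<1::real}) T (\<lambda>_. p)"
    unfolding smooth_map_def
  proof (intro conjI ballI)
    show "continuous_map (top_of_set {-1<..<1::real}) T (\<lambda>_. p)" using assms by simp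
    show "\<exists>P U g. openin (top_of_set {-1<..<1::real}) P \<and> t \<in> P \<and> P \<subseteq> U \<and> open U \<and> smooth_on U g \<and> (\<forall>x\<in>P. p = g x)"
      if "t \<in> topspace (top_of_set {-1<..<1::real})" for t
      using that by (intro exI[of _ "{-1<..<1}"] exI[of _ "\<lambda>_. p"]) (auto intro: smooth_on_const)
  qed
  moreover have "((\<lambda>_::real. p) has_vector_derivative 0) (at 0)"
    by (rule has_vector_derivative_const)
  ultimately show ?thesis
    unfolding tangent_space_def using zero_less_one[where 'a=real] by blast
qed

lemma has_vector_derivative_compose_at:
  assumes "(f has_vector_derivative f') (at t)" "(g has_derivative g') (at (f t))"
  shows "((\<lambda>s. g (f s)) has_vector_derivative g' f') (at t)"
  using vector_derivative_diff_chain_within[of f f' t UNIV g g'] assms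
  by (simp add: has_derivative_at_withinI o_def)

text \<open>In a chart adapted to the algebroid the tangent vector \<open>(v, 0, 0)\<close> at a unit is the velocity of a curve
  of material isomorphisms. Differentiating the defining equation along it shows that the response,
  read in the chart, does not depend on the body point.\<close>

lemma response_derivative_zero:
  fixes W :: "3 jet \<Rightarrow> 'v::real_normed_vector"
  assumes B: "open B" and W: "W differentiable_on B \<times> B \<times> GL"
    and T: "topspace T = material_groupoid B W"
    and UB: "U \<subseteq> B" and d: "diffeomorphism U V \<phi>"
    and alg: "\<And>y v. y \<in> V \<Longrightarrow> (y, v, 0) \<in> algebroid_coords \<phi> ` {a \<in> lie_algebroid B T. fst a \<in> U}"
    and x: "x \<in> V" and F: "invertible F"
  shows "((\<lambda>y. W (inv_into U \<phi> y, inv_into U \<phi> y, F ** jacobian \<phi> (inv_into U \<phi> y))) has_derivative (\<lambda>_. 0)) (at x)"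
proof -
  let ?\<psi> = "inv_into U \<phi>"
  let ?J = "jacobian \<phi>"
  have opn: "open U" "open V" and bij: "bij_betw \<phi> U V" and sm: "smooth_on U \<phi>" "smooth_on V ?\<psi>"
    using d by (auto simp: diffeomorphism_def)
  have \<psi>: "?\<psi> y \<in> U" "\<phi> (?\<psi> y) = y" if "y \<in> V" for y
    using bij that by (auto simp: bij_betw_def inv_into_into f_inv_into_f)
  have \<psi>\<phi>: "?\<psi> (\<phi> z) = z" "\<phi> z \<in> V" if "z \<in> U" for z
    using bij that by (auto simp: bij_betw_def)
  \<comment> \<open>\<open>?m (y, F)\<close> is the jet from the body point with coordinate
    \<open>y\<close> to itself whose matrix is \<open>F\<close> after passing to the chart on the
    source side; \<open>?H\<close> is the response in these variables.\<close>
  let ?m = "\<lambda>q. (?\<psi> (fst q), ?\<psi> (fst q), snd q ** ?J (?\<psi> (fst q)))"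
  let ?H = "\<lambda>q. W (?m q)"
  have VG: "open (V \<times> (GL :: (real^3^3) set))" using opn open_GL by (intro open_Times)
  have f1: "smooth_on (V \<times> (GL :: (real^3^3) set)) (\<lambda>q. fst q)" and f2: "smooth_on (V \<times> (GL :: (real^3^3) set)) (\<lambda>q. snd q)"
    using VG by (auto intro!: smooth_on_bounded_linear bounded_linear_fst bounded_linear_snd)
  have \<psi>f: "smooth_on (V \<times> (GL :: (real^3^3) set)) (\<lambda>q. ?\<psi> (fst q))"
    by (rule smooth_on_compose[OF VG f1 sm(2)]) auto
  have "smooth_on (V \<times> (GL :: (real^3^3) set)) (\<lambda>q. ?J (?\<psi> (fst q)))"
    by (rule smooth_on_compose[OF VG \<psi>f smooth_on_jacobian[OF opn(1) sm(1)]]) (use \<psi>(1) in auto)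
  then have "smooth_on (V \<times> GL) ?m"
    by (intro smooth_on_Pair smooth_on_matrix_mult VG \<psi>f f2)
  then have m': "(?m has_derivative frechet_derivative ?m (at (x, F))) (at (x, F))"
    by (rule smooth_on_has_derivative) (use x F in simp)
  have JF: "invertible (?J (?\<psi> x))"
    using d \<psi>(1)[OF x] by (rule invertible_jacobian)
  have "?m (x, F) \<in> B \<times> B \<times> GL" using \<psi>(1)[OF x] UB F JF by (auto intro: invertible_mult)
  moreover have "open (B \<times> B \<times> (GL :: (real^3^3) set))" using B open_GL by (intro open_Times)
  ultimately have "W differentiable (at (?m (x, F)))"
    using W by (metis differentiable_on_eq_differentiable_at)
  then obtain W' where "(W has_derivative W') (at (?m (x, F)))"
    by (auto simp: differentiable_def)
  then obtain H' where H': "(?H has_derivative H') (at (x, F))"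
    using has_derivative_compose[OF m'] by blast
  have Hv: "H' (v, 0) = 0" for v
  proof -
    obtain X w where Xw: "(X, w) \<in> lie_algebroid B T" "X \<in> U" "algebroid_coords \<phi> (X, w) = (x, v, 0)"
      using alg[OF x, of v] by force
    let ?D = "frechet_derivative (jet_coords \<phi>) (at (jid X))"
    have w: "w \<in> tangent_space T (jid X)" "jtgt w = 0"
      using Xw(1) by (auto simp: lie_algebroid_def frechet_derivative_jtgt)
    have Dw: "\<phi> X = x" "jsrc (?D w) = v" "jlin (?D w) = 0"
      using Xw(3) by (auto simp: algebroid_coords_def Let_def)
    \<comment> \<open>Algebroid vectors have no target component, so \<open>?D w\<close> is exactly
      \<open>(v, 0, 0)\<close>.\<close>
    have Dw2: "jtgt (?D w) = 0"
      using jet_coords_derivative(3)[OF d Xw(2), of w] w(2) linear_0[OF diffeomorphism_derivative(2)[OF d Xw(2)]]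
      by simp
    obtain e \<gamma> where e: "e > 0" "smooth_map (top_of_set {-e<..<e}) T \<gamma>" "\<gamma> 0 = jid X"
      and \<gamma>': "(\<gamma> has_vector_derivative w) (at 0)"
      using w(1) by (auto simp: tangent_space_def)
    obtain \<delta> where \<delta>: "\<delta> > 0" "\<gamma> ` {-\<delta><..<\<delta>} \<subseteq> material_groupoid B W"
      using smooth_curve_imp_smooth_on[OF e(2,1)] T by metis
    have "((\<lambda>t. jet_coords \<phi> (\<gamma> t)) has_vector_derivative ?D w) (at 0)"
      by (rule has_vector_derivative_compose_at[OF \<gamma>']) (simp add: e(3) jet_coords_derivative(1)[OF d Xw(2)])
    then have \<Gamma>': "((\<lambda>t. jet_coords \<phi> (\<gamma> t)) has_vector_derivative (v, 0, 0)) (at 0)"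
      using Dw(2,3) Dw2 by (metis jsrc_def jtgt_def jlin_def prod.collapse)
    define a b P where "a t = fst (jet_coords \<phi> (\<gamma> t))" and "b t = fst (snd (jet_coords \<phi> (\<gamma> t)))"
      and "P t = snd (snd (jet_coords \<phi> (\<gamma> t)))" for t
    have a': "(a has_vector_derivative v) (at 0)" and b': "(b has_vector_derivative 0) (at 0)"
      and P': "(P has_vector_derivative 0) (at 0)"
      using bounded_linear.has_vector_derivative[OF bounded_linear_fst \<Gamma>']
        bounded_linear.has_vector_derivative[OF bounded_linear_fst
          bounded_linear.has_vector_derivative[OF bounded_linear_snd \<Gamma>']]
        bounded_linear.has_vector_derivative[OF bounded_linear_snd
          bounded_linear.has_vector_derivative[OF bounded_linear_snd \<Gamma>']]
      by (simp_all add: a_def[abs_def] b_def[abs_def] P_def[abs_def])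
    have init: "a 0 = x" "b 0 = x" "P 0 = mat 1"
      using invertible_jacobian[OF d Xw(2)]
      by (simp_all add: a_def b_def P_def e(3) jid_eq jet_coords_eq Dw(1) matrix_inv_cancel)
    \<comment> \<open>On the source side of the material equation \<open>P\<close> is stationary at
      0, so only the point moves, with velocity \<open>v\<close>. The target side is stationary
      altogether.\<close>
    have "((\<lambda>t. (a t, F ** P t)) has_vector_derivative (v, F ** 0)) (at 0)"
      by (intro has_vector_derivative_Pair a'
          bounded_linear.has_vector_derivative[OF bounded_bilinear.bounded_linear_right[OF bounded_bilinear_matrix_mult] P'])
    then have "((\<lambda>t. ?H (a t, F ** P t)) has_vector_derivative H' (v, F ** 0)) (at 0)"
      by (rule has_vector_derivative_compose_at) (simp add: init H')
    moreover have "F ** 0 = (0 :: real^3^3)" by (simp add: matrix_matrix_mult_def vec_eq_iff)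
    ultimately have 1: "((\<lambda>t. ?H (a t, F ** P t)) has_vector_derivative H' (v, 0)) (at 0)" by simp
    have "((\<lambda>t. (b t, F)) has_vector_derivative (0, 0)) (at 0)"
      by (intro has_vector_derivative_Pair b' has_vector_derivative_const)
    then have "((\<lambda>t. ?H (b t, F)) has_vector_derivative H' (0, 0)) (at 0)"
      by (rule has_vector_derivative_compose_at) (simp add: init H')
    moreover have "H' (0, 0) = 0"
      using linear_0[OF has_derivative_linear[OF H']] by (simp add: zero_prod_def)
    ultimately have 2: "((\<lambda>t. ?H (b t, F)) has_vector_derivative 0) (at 0)" by simp
    \<comment> \<open>For small times the curve stays over the chart domain, where the material
      equation can be read in coordinates.\<close>
    have "(\<gamma> \<longlongrightarrow> jid X) (nhds 0)"
      using has_vector_derivative_continuous[OF \<gamma>'] e(3) by (metis isCont_def tendsto_at_iff_tendsto_nhds)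
    moreover have "open (U \<times> U \<times> (GL :: (real^3^3) set))" using opn open_GL by (intro open_Times)
    moreover have "jid X \<in> U \<times> U \<times> GL" using Xw(2) by (simp add: jid_eq invertible_mat_1)
    ultimately have "\<forall>\<^sub>F t in nhds 0. \<gamma> t \<in> U \<times> U \<times> GL" by (rule topological_tendstoD)
    moreover have "\<forall>\<^sub>F t in nhds 0. t \<in> {-\<delta><..<\<delta>}"
      by (rule eventually_nhds_in_open) (use \<delta>(1) in auto)
    ultimately have "\<forall>\<^sub>F t in nhds 0. ?H (a t, F ** P t) = ?H (b t, F)"
    proof eventually_elim
      case (elim t)
      obtain X1 Y1 Q where g: "\<gamma> t = (X1, Y1, Q)" by (metis prod.exhaust)
      have U1: "X1 \<in> U" "Y1 \<in> U" using elim g by auto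
      have inv: "invertible (?J X1)" "invertible (?J Y1)"
        using invertible_jacobian[OF d] U1 by auto
      have "(X1, Y1, Q) \<in> material_groupoid B W" using \<delta>(2) elim g by (metis image_subset_iff)
      \<comment> \<open>Taken at \<open>F ** ?J Y1\<close>, the material equation loses all chart
        Jacobians once expressed through \<open>?H\<close>.\<close>
      then have "W (X1, X1, (F ** ?J Y1) ** Q) = W (Y1, Y1, F ** ?J Y1)"
        unfolding material_groupoid_iff[OF B] using F inv(2) invertible_mult by blast
      moreover have "F ** (?J Y1 ** Q ** matrix_inv (?J X1)) ** ?J X1 = (F ** ?J Y1) ** Q"
        using inv(1) by (simp add: matrix_mul_assoc matrix_mult_inv_cancel)
      ultimately show ?case
        using U1 by (simp add: a_def b_def P_def g jet_coords_eq \<psi>\<phi>)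
    qed
    then obtain A where A: "open A" "0 \<in> A" "\<And>t. t \<in> A \<Longrightarrow> ?H (a t, F ** P t) = ?H (b t, F)"
      by (auto simp: eventually_nhds)
    have "((\<lambda>t. ?H (b t, F)) has_vector_derivative H' (v, 0)) (at 0)"
      using 1 A by (rule has_vector_derivative_transform_within_open)
    then show ?thesis using 2 by (rule vector_derivative_unique_at)
  qed
  have "((\<lambda>y. ?H (y, F)) has_derivative (\<lambda>h. H' (h, 0))) (at x)"
    by (rule has_derivative_compose[OF has_derivative_Pair[OF has_derivative_ident has_derivative_const] H'])
  then show ?thesis by (simp add: Hv)
qed

text \<open>On a chart ball the response read in the chart has zero derivative, hence is constant
  there. The chart itself is then a homogeneous configuration of the neighbourhood over that
  ball.\<close>

lemma integrable_imp_locally_homogeneous: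
  fixes W :: "3 jet \<Rightarrow> 'v::real_normed_vector"
  assumes body: "body B W" and T: "topspace T = material_groupoid B W"
    and G: "lie_subgroup_GL G" and int: "integrable_by B (lie_algebroid B T) G"
  shows "locally_homogeneous B W"
proof -
  have B: "open B" and W: "W differentiable_on B \<times> B \<times> GL"
    using body by (auto simp: body_def Pi1_eq)
  have "\<exists>U'. open U' \<and> X0 \<in> U' \<and> U' \<subseteq> B \<and> homogeneous U' W" if X0: "X0 \<in> B" for X0
  proof -
    obtain U \<phi> where U: "X0 \<in> U" "chart_on B U \<phi>"
      and alg: "algebroid_coords \<phi> ` {a \<in> lie_algebroid B T. fst a \<in> U} = \<phi> ` U \<times> UNIV \<times> lie_algebra_of G"
      using int X0 unfolding integrable_by_def by blast
    have UB: "U \<subseteq> B" and d: "diffeomorphism U (\<phi> ` U) \<phi>" using U(2) by (auto simp: chart_on_def)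
    have opn: "open U" "open (\<phi> ` U)" and inj: "inj_on \<phi> U" and sm: "smooth_on U \<phi>"
      using d by (auto simp: diffeomorphism_def bij_betw_def)
    let ?\<psi> = "inv_into U \<phi>"
    let ?J = "jacobian \<phi>"
    \<comment> \<open>With 0 in the Lie algebra, every \<open>v\<close> occurs in the algebroid
      together with a vanishing matrix part.\<close>
    have "0 \<in> lie_algebra_of G"
      using G by (auto simp: lie_algebra_of_def lie_subgroup_GL_def intro: zero_mem_tangent_space)
    then have alg0: "(y, v, 0) \<in> algebroid_coords \<phi> ` {a \<in> lie_algebroid B T. fst a \<in> U}" if "y \<in> \<phi> ` U" for y v
      unfolding alg using that by auto
    \<comment> \<open>A ball is convex, so vanishing derivative implies constancy on it.\<close>
    obtain r where r: "r > 0" "ball (\<phi> X0) r \<subseteq> \<phi> ` U"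
      using opn(2) U(1) openE by blast
    define U' where "U' = U \<inter> \<phi> -` ball (\<phi> X0) r"
    have U': "open U'" "U' \<subseteq> U" "X0 \<in> U'"
      unfolding U'_def using r(1) U(1)
      by (auto intro!: continuous_open_preimage smooth_on_continuous_on[OF sm] opn)
    have d': "diffeomorphism U' (\<phi> ` U') \<phi>" using d U'(1,2) by (rule diffeomorphism_restrict)
    have const: "W (X, X, F ** ?J X) = W (Y, Y, F ** ?J Y)"
      if X: "X \<in> U'" "Y \<in> U'" and F: "invertible F" for X Y F
    proof -
      let ?u = "\<lambda>y. W (?\<psi> y, ?\<psi> y, F ** ?J (?\<psi> y))"
      have du: "(?u has_derivative (\<lambda>_. 0)) (at y within ball (\<phi> X0) r)" if y: "y \<in> ball (\<phi> X0) r" for y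
        by (rule has_derivative_at_withinI, rule response_derivative_zero[OF B W T UB d alg0 _ F])
          (use r(2) y in auto)
      obtain c where "\<forall>y\<in>ball (\<phi> X0) r. ?u y = c"
        using has_derivative_zero_constant[of "ball (\<phi> X0) r" ?u, OF convex_ball du] by (rule exE)
      then have "?u (\<phi> X) = ?u (\<phi> Y)" using X by (simp add: U'_def)
      then show ?thesis using X inj by (simp add: U'_def)
    qed
    have "homogeneous U' W"
      unfolding homogeneous_def
    proof (intro exI[of _ \<phi>] conjI ballI)
      show "deformation U' \<phi>" using d' by (simp add: deformation_iff_diffeomorphism[OF U'(1)])
      fix X Y assume X: "X \<in> U'" "Y \<in> U'"
      have inv: "invertible (?J X)" "invertible (?J Y)"
        using invertible_jacobian[OF d'] X by auto
      \<comment> \<open>Constancy, taken at \<open>F ** matrix_inv (?J Y)\<close>, is the material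
        equation for the translation jet.\<close>
      have "W (X, X, F ** (matrix_inv (?J Y) ** ?J X)) = W (Y, Y, F)" if F: "invertible F" for F
        using const[OF X, of "F ** matrix_inv (?J Y)"] F inv
        by (simp add: invertible_mult invertible_matrix_inv matrix_mult_inv_cancel matrix_mul_assoc)
      then show "jet1 (inv_into U' \<phi> \<circ> translate (\<phi> Y - \<phi> X) \<circ> \<phi>) X \<in> material_groupoid U' W"
        unfolding jet1_translation_conjugate[OF d' X] material_groupoid_iff[OF U'(1)]
        using X inv by (simp add: invertible_mult invertible_matrix_inv)
    qed
    then show ?thesis using U' UB by blast
  qed
  then obtain N where "\<And>X. X \<in> B \<Longrightarrow> open (N X) \<and> X \<in> N X \<and> N X \<subseteq> B \<and> homogeneous (N X) W"
    by metis
  then show ?thesis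
    unfolding locally_homogeneous_def by (intro exI[of _ "N ` B"]) blast
qed

subsection \<open>From homogeneity to integrability\<close>

lemma smooth_curve_in_tangent_space:
  assumes "e > 0" "smooth_on {-e<..<e} c" "c ` {-e<..<e} \<subseteq> S" "(c has_vector_derivative w) (at 0)"
  shows "w \<in> tangent_space (top_of_set S) (c 0)"
proof -
  have "smooth_map (top_of_set {-e<..<e}) (top_of_set S) c"
    unfolding smooth_map_def
  proof (intro conjI ballI)
    show "continuous_map (top_of_set {-e<..<e}) (top_of_set S) c"
      using smooth_on_continuous_on[OF assms(2)] assms(3) by auto
    show "\<exists>P U g. openin (top_of_set {-e<..<e}) P \<and> t \<in> P \<and> P \<subseteq> U \<and> open U \<and> smooth_on U g \<and> (\<forall>x\<in>P. c x = g x)"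
      if "t \<in> topspace (top_of_set {-e<..<e})" for t
      using that assms(2) by (intro exI[of _ "{-e<..<e}"] exI[of _ c]) auto
  qed
  then show ?thesis
    unfolding tangent_space_def using assms(1,4) by blast
qed

lemma smooth_map_top_of_set:
  assumes "open U" "S \<subseteq> U" "smooth_on U f" "f ` S \<subseteq> S'"
  shows "smooth_map (top_of_set S) (top_of_set S') f"
  unfolding smooth_map_def
proof (intro conjI ballI)
  show "continuous_map (top_of_set S) (top_of_set S') f"
    using continuous_on_subset[OF smooth_on_continuous_on[OF assms(3)] assms(2)] assms(4) by auto
  show "\<exists>P U g. openin (top_of_set S) P \<and> p \<in> P \<and> P \<subseteq> U \<and> open U \<and> smooth_on U g \<and> (\<forall>x\<in>P. f x = g x)"
    if "p \<in> topspace (top_of_set S)" for p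
    using that assms by (intro exI[of _ S] exI[of _ U] exI[of _ f]) auto
qed

text \<open>Left translations move a straightening near one point of a matrix group to all its points.\<close>

lemma lie_subgroup_GL_of_chart:
  fixes G :: "(real^'n^'n) set" and \<Psi> :: "real^'n^'n \<Rightarrow> real^'n^'n"
  assumes GL: "G \<subseteq> GL" and one: "mat 1 \<in> G" and inv: "\<And>A. A \<in> G \<Longrightarrow> matrix_inv A \<in> G"
    and mult: "\<And>A C. A \<in> G \<Longrightarrow> C \<in> G \<Longrightarrow> A ** C \<in> G"
    and chart: "g0 \<in> G" "g0 \<in> U" "diffeomorphism U V \<Psi>" "subspace E" "dim E = m" "\<Psi> ` (U \<inter> G) = V \<inter> E"
  shows "embedded_submanifold m G" "lie_subgroup_GL (top_of_set G)"
proof -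
  show emb: "embedded_submanifold m G"
    unfolding embedded_submanifold_def
  proof
    fix g assume g: "g \<in> G"
    define A where "A = g0 ** matrix_inv g"
    have A: "A \<in> G" "invertible A" using g chart(1) inv mult GL by (auto simp: A_def)
    have iA: "matrix_inv A \<in> G" using A(1) by (rule inv)
    have Ag: "A ** g = g0" using g GL by (auto simp: A_def matrix_mult_inv_cancel)
    define U1 where "U1 = (\<lambda>Z. A ** Z) -` U"
    let ?\<Psi> = "\<lambda>Z. \<Psi> (A ** Z)"
    have opn: "open U" and sm: "smooth_on U \<Psi>" and bij: "bij_betw \<Psi> U V"
      using chart(3) by (auto simp: diffeomorphism_def)
    have bl: "bounded_linear (\<lambda>Z. A ** (Z :: real^'n^'n))"
      by (rule bounded_bilinear.bounded_linear_right[OF bounded_bilinear_matrix_mult])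
    have injA: "inj (\<lambda>Z. A ** (Z :: real^'n^'n))"
      using A(2) by (metis injI matrix_mult_inv_cancel(4))
    have U1: "open U1"
      unfolding U1_def using opn linear_continuous_on[OF bl] by (intro open_vimage) auto
    have AU1: "(\<lambda>Z. A ** Z) ` U1 \<subseteq> U" by (auto simp: U1_def)
    have "diffeomorphism U1 (?\<Psi> ` U1) ?\<Psi>"
    proof (rule diffeomorphism_image[OF U1])
      show "smooth_on U1 ?\<Psi>"
        by (rule smooth_on_compose[OF U1 smooth_on_bounded_linear[OF bl U1] sm AU1])
      show "inj_on ?\<Psi> U1"
        using bij injA by (auto simp: U1_def inj_on_def bij_betw_def)
      fix Z assume Z: "Z \<in> U1"
      then have AZ: "A ** Z \<in> U" by (simp add: U1_def)
      have "(?\<Psi> has_derivative (\<lambda>H. frechet_derivative \<Psi> (at (A ** Z)) (A ** H))) (at Z)"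
        by (rule has_derivative_compose[OF bounded_linear_imp_has_derivative[OF bl]
              diffeomorphism_derivative(1)[OF chart(3) AZ]])
      then have "frechet_derivative ?\<Psi> (at Z) = (\<lambda>H. frechet_derivative \<Psi> (at (A ** Z)) (A ** H))"
        by (rule frechet_derivative_at[symmetric])
      then show "inj (frechet_derivative ?\<Psi> (at Z))"
        using inj_compose[OF diffeomorphism_derivative(3)[OF chart(3) AZ] injA] by (simp add: o_def)
    qed
    moreover have "?\<Psi> ` (U1 \<inter> G) = ?\<Psi> ` U1 \<inter> E"
    proof -
      have surj: "Z \<in> (\<lambda>Z. A ** Z) ` U1" if "Z \<in> U" for Z
        using that A(2) by (intro image_eqI[of _ _ "matrix_inv A ** Z"]) (auto simp: U1_def matrix_mult_inv_cancel)
      have "(\<lambda>Z. A ** Z) ` U1 = U" using AU1 surj by blast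
      then have 1: "?\<Psi> ` U1 = V" using bij by (metis bij_betw_def image_image)
      have "(\<lambda>Z. A ** Z) ` (U1 \<inter> G) = U \<inter> G"
      proof
        show "(\<lambda>Z. A ** Z) ` (U1 \<inter> G) \<subseteq> U \<inter> G" using A(1) mult by (auto simp: U1_def)
        show "U \<inter> G \<subseteq> (\<lambda>Z. A ** Z) ` (U1 \<inter> G)"
        proof
          fix Z assume Z: "Z \<in> U \<inter> G"
          have "matrix_inv A ** Z \<in> G" using Z iA mult by blast
          then show "Z \<in> (\<lambda>Z. A ** Z) ` (U1 \<inter> G)"
            using Z A(2) by (intro image_eqI[of _ _ "matrix_inv A ** Z"]) (auto simp: U1_def matrix_mult_inv_cancel)
        qed
      qed
      then have "?\<Psi> ` (U1 \<inter> G) = \<Psi> ` (U \<inter> G)" by (metis image_image)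
      then show ?thesis using 1 chart(6) by simp
    qed
    moreover have "g \<in> U1" using Ag chart(2) by (simp add: U1_def)
    ultimately show "\<exists>U V (\<Phi> :: real^'n^'n \<Rightarrow> real^'n^'n) L. g \<in> U \<and> diffeomorphism U V \<Phi> \<and>
        subspace L \<and> dim L = m \<and> \<Phi> ` (U \<inter> G) = V \<inter> L"
      using chart(4,5) by blast
  qed
  show "lie_subgroup_GL (top_of_set G)"
    unfolding lie_subgroup_GL_def topspace_euclidean_subtopology
  proof (intro conjI)
    show "smooth_map (top_of_set G) (top_of_set G) matrix_inv"
      using GL inv by (intro smooth_map_top_of_set[OF open_GL _ smooth_on_matrix_inv]) auto
    have "smooth_on UNIV (\<lambda>q :: (real^'n^'n) \<times> (real^'n^'n). fst q ** snd q)"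
      by (intro smooth_on_matrix_mult smooth_on_bounded_linear bounded_linear_fst bounded_linear_snd) auto
    then have "smooth_map (top_of_set (G \<times> G)) (top_of_set G) (\<lambda>q. fst q ** snd q)"
      using mult by (intro smooth_map_top_of_set[OF open_UNIV]) auto
    then show "smooth_map (prod_topology (top_of_set G) (top_of_set G)) (top_of_set G) (\<lambda>(A, C). A ** C)"
      by (simp add: prod_topology_subtopology(1)[symmetric] euclidean_product_topology subtopology_Times case_prod_unfold)
  qed (use GL one inv mult embedded_submanifold_imp_immersed[OF emb] in auto)
qed

text \<open>Serves the empty body, where integrability is vacuous but some group must still be
  named: the full general linear group, straightened by the identity.\<close>

lemma exists_lie_subgroup_GL: "\<exists>G :: (real^'n^'n) topology. lie_subgroup_GL G"
proof -
  have "diffeomorphism GL ((\<lambda>A. A) ` GL) (\<lambda>A :: real^'n^'n. A)"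
  proof (rule diffeomorphism_image[OF open_GL])
    show "inj (frechet_derivative (\<lambda>A. A) (at A))" for A :: "real^'n^'n"
      using frechet_derivative_at[OF has_derivative_ident, of A] by (metis inj_on_id2)
  qed (auto intro: smooth_on_ident open_GL)
  then have "lie_subgroup_GL (top_of_set (GL :: (real^'n^'n) set))"
    by (intro lie_subgroup_GL_of_chart(2)[where ?g0.0 = "mat 1" and U = GL and E = UNIV and \<Psi> = "\<lambda>A. A"])
      (auto intro: invertible_mult invertible_matrix_inv invertible_mat_1)
  then show ?thesis by blast
qed

text \<open>In the chart \<open>\<kappa>\<close> the material groupoid of a homogeneous body is the trivial groupoid
  with a closed isotropy group, the symmetry group of the response at one point.\<close>

lemma homogeneous_material_groupoid:
  fixes W :: "3 jet \<Rightarrow> 'v::real_normed_vector"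
  assumes B: "open B" "X0 \<in> B" and W: "continuous_on (B \<times> B \<times> GL) W"
    and d: "diffeomorphism B V \<kappa>"
    and hom: "\<And>X Y. X \<in> B \<Longrightarrow> Y \<in> B \<Longrightarrow>
      (X, Y, matrix_inv (jacobian \<kappa> Y) ** jacobian \<kappa> X) \<in> material_groupoid B W"
  obtains G where "G \<subseteq> GL" "mat 1 \<in> G" "\<And>A. A \<in> G \<Longrightarrow> matrix_inv A \<in> G"
    "\<And>A C. A \<in> G \<Longrightarrow> C \<in> G \<Longrightarrow> A ** C \<in> G" "closedin (top_of_set GL) G"
    "\<And>X Y P. (X, Y, P) \<in> material_groupoid B W \<longleftrightarrow>
      X \<in> B \<and> Y \<in> B \<and> invertible P \<and> jacobian \<kappa> Y ** P ** matrix_inv (jacobian \<kappa> X) \<in> G"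
proof -
  let ?J = "jacobian \<kappa>"
  note J = invertible_jacobian[OF d]
  \<comment> \<open>\<open>h\<close> is the response at \<open>X0\<close> with matrices read in the
    chart on the source side; \<open>G\<close> is its group of right symmetries.\<close>
  define h where "h F = W (X0, X0, F ** ?J X0)" for F
  define G where "G = {g. invertible g \<and> (\<forall>F. invertible F \<longrightarrow> h (F ** g) = h F)}"
  \<comment> \<open>The translation jet from \<open>X\<close> to \<open>X0\<close> is a material
    isomorphism, so the response at any point is expressed by \<open>h\<close>.\<close>
  have Wh: "W (X, X, F) = h (F ** matrix_inv (?J X))" if X: "X \<in> B" and F: "invertible F" for X F
  proof -
    have "W (X, X, (F ** matrix_inv (?J X) ** ?J X0) ** (matrix_inv (?J X0) ** ?J X))
        = W (X0, X0, F ** matrix_inv (?J X) ** ?J X0)"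
      using hom[OF X B(2)] J[OF X] J[OF B(2)] F
      unfolding material_groupoid_iff[OF B(1)] by (simp add: invertible_mult invertible_matrix_inv)
    then show ?thesis
      using J[OF X] J[OF B(2)] by (simp add: h_def matrix_mul_assoc matrix_mult_inv_cancel)
  qed
  \<comment> \<open>Expressed by \<open>h\<close>, the material equation of \<open>P\<close> is
    invariance of \<open>h\<close> under right multiplication by the chart matrix of
    \<open>P\<close>.\<close>
  have iff: "(X, Y, P) \<in> material_groupoid B W \<longleftrightarrow>
      X \<in> B \<and> Y \<in> B \<and> invertible P \<and> ?J Y ** P ** matrix_inv (?J X) \<in> G" for X Y P
  proof -
    have "(\<forall>F. invertible F \<longrightarrow> W (X, X, F ** P) = W (Y, Y, F)) \<longleftrightarrow> ?J Y ** P ** matrix_inv (?J X) \<in> G"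
      if X: "X \<in> B" "Y \<in> B" and P: "invertible P"
    proof
      assume l: "\<forall>F. invertible F \<longrightarrow> W (X, X, F ** P) = W (Y, Y, F)"
      have "h (F ** (?J Y ** P ** matrix_inv (?J X))) = h F" if F: "invertible F" for F
      proof -
        have "W (X, X, (F ** ?J Y) ** P) = W (Y, Y, F ** ?J Y)"
          using l F J[OF X(2)] invertible_mult by blast
        then show ?thesis
          using Wh[OF X(1), of "(F ** ?J Y) ** P"] Wh[OF X(2), of "F ** ?J Y"] F P J[OF X(2)]
          by (simp add: invertible_mult matrix_mul_assoc matrix_mult_inv_cancel)
      qed
      then show "?J Y ** P ** matrix_inv (?J X) \<in> G"
        using J[OF X(1)] J[OF X(2)] P by (simp add: G_def invertible_mult invertible_matrix_inv)
    next
      assume r: "?J Y ** P ** matrix_inv (?J X) \<in> G"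
      show "\<forall>F. invertible F \<longrightarrow> W (X, X, F ** P) = W (Y, Y, F)"
      proof (intro allI impI)
        fix F :: "real^3^3" assume F: "invertible F"
        have "h ((F ** matrix_inv (?J Y)) ** (?J Y ** P ** matrix_inv (?J X))) = h (F ** matrix_inv (?J Y))"
          using r F J[OF X(2)] by (simp add: G_def invertible_mult invertible_matrix_inv)
        then show "W (X, X, F ** P) = W (Y, Y, F)"
          using Wh[OF X(1), of "F ** P"] Wh[OF X(2) F] F P J[OF X(2)]
          by (simp add: invertible_mult matrix_mul_assoc matrix_mult_inv_cancel)
      qed
    qed
    then show ?thesis unfolding material_groupoid_iff[OF B(1)] by blast
  qed
  have "continuous_on GL (\<lambda>F. (X0, X0, F ** ?J X0))"
    using linear_continuous_on[OF bounded_bilinear.bounded_linear_left[OF bounded_bilinear_matrix_mult]]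
    by (intro continuous_intros) auto
  then have conth: "continuous_on GL h"
    unfolding h_def using B(2) J[OF B(2)]
    by (intro continuous_on_compose2[OF W]) (auto intro: invertible_mult)
  \<comment> \<open>For each \<open>F\<close>, invariance at \<open>F\<close> is a closed condition
    by continuity of the response; \<open>G\<close> is the intersection of these conditions.\<close>
  have "closedin (top_of_set GL) {g \<in> GL. h (F ** g) = h F}" if F: "invertible F" for F
  proof (rule continuous_closedin_preimage_constant)
    have "continuous_on GL (\<lambda>g. F ** g)"
      by (rule linear_continuous_on[OF bounded_bilinear.bounded_linear_right[OF bounded_bilinear_matrix_mult]])
    then show "continuous_on GL (\<lambda>g. h (F ** g))"
      by (rule continuous_on_compose2[OF conth]) (use F in \<open>auto intro: invertible_mult\<close>)
  qed
  then have "closedin (top_of_set GL) (\<Inter>F\<in>GL. {g \<in> GL. h (F ** g) = h F})"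
    using invertible_mat_1 by (intro closedin_INT) auto
  moreover have "(\<Inter>F\<in>GL. {g \<in> GL. h (F ** g) = h F}) = G"
    using invertible_mat_1 by (auto simp: G_def)
  ultimately have closed: "closedin (top_of_set GL) G" by simp
  show thesis
  proof (rule that[OF _ _ _ _ closed iff])
    show "G \<subseteq> GL" "mat 1 \<in> G" by (auto simp: G_def invertible_mat_1)
    show "A ** C \<in> G" if "A \<in> G" "C \<in> G" for A C
      using that by (auto simp: G_def invertible_mult matrix_mul_assoc)
    show "matrix_inv A \<in> G" if A: "A \<in> G" for A
    proof -
      have "h (F ** matrix_inv A) = h F" if "invertible F" for F
      proof -
        have "h ((F ** matrix_inv A) ** A) = h (F ** matrix_inv A)"
          using A that by (auto simp: G_def invertible_mult invertible_matrix_inv)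
        then show ?thesis using A by (simp add: G_def matrix_mult_inv_cancel)
      qed
      then show ?thesis using A by (simp add: G_def invertible_matrix_inv)
    qed
  qed
qed

text \<open>Near some jet from \<open>X\<close> to \<open>Y\<close>, supplied by Baire's theorem,
  the groupoid is embedded. Its fibre over \<open>(X, Y)\<close> is \<open>G\<close> in the chart,
  and the fibre of all jets is transversal to it because source and target can move freely with the
  chart matrix held fixed.\<close>

lemma isotropy_group_chart:
  fixes T :: "('n::finite) jet topology" and \<kappa> :: "real^'n \<Rightarrow> real^'n"
  assumes B: "open B" "B \<noteq> {}" and d: "diffeomorphism B V0 \<kappa>"
    and G: "G \<subseteq> GL" "mat 1 \<in> G" "closedin (top_of_set GL) G"
    and iff: "\<And>X Y P. (X, Y, P) \<in> topspace T \<longleftrightarrow>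
      X \<in> B \<and> Y \<in> B \<and> invertible P \<and> jacobian \<kappa> Y ** P ** matrix_inv (jacobian \<kappa> X) \<in> G"
    and T: "immersed_submanifold k T"
  obtains g0 U V and \<Psi> :: "real^'n^'n \<Rightarrow> real^'n^'n" and E where "g0 \<in> G" "g0 \<in> U" "diffeomorphism U V \<Psi>"
    "subspace E" "dim E + 2 * CARD('n) = k" "\<Psi> ` (U \<inter> G) = V \<inter> E"
proof -
  let ?J = "jacobian \<kappa>"
  note J = invertible_jacobian[OF d]
  have sm\<kappa>: "smooth_on B \<kappa>" using d by (auto simp: diffeomorphism_def)
  let ?\<Omega> = "topspace T"
  let ?JB = "B \<times> B \<times> (GL :: (real^'n^'n) set)"
  let ?q = "\<lambda>j. snd (snd (jet_coords \<kappa> j))"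
  have opJ: "open ?JB" using B(1) open_GL by (intro open_Times)
  \<comment> \<open>The groupoid is closed in an open subset of Euclidean space, hence completely
    metrizable in the ambient topology.\<close>
  have \<Omega>: "?\<Omega> = ?JB \<inter> ?q -` G"
    by (auto simp: iff jet_coords_eq)
  have contq: "continuous_on ?JB ?q"
    using smooth_on_continuous_on[OF smooth_on_jet_coords[OF d]] by (intro continuous_on_snd)
  have "closedin (top_of_set ?JB) (?JB \<inter> ?q -` G)"
    using contq _ G(3)
    by (rule continuous_closedin_preimage_gen)
      (auto simp: jet_coords_eq intro!: invertible_mult invertible_matrix_inv J)
  then have cl: "closedin (top_of_set ?JB) ?\<Omega>" by (simp add: \<Omega>)
  have "completely_metrizable_space (top_of_set ?JB)"
    using opJ by (intro completely_metrizable_space_openin completely_metrizable_space_euclidean) simp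
  then have "completely_metrizable_space (subtopology (top_of_set ?JB) ?\<Omega>)"
    using cl by (rule completely_metrizable_space_closedin)
  moreover have "subtopology (top_of_set ?JB) ?\<Omega> = top_of_set ?\<Omega>"
    by (simp add: subtopology_subtopology \<Omega> Int_assoc[symmetric])
  ultimately have cm: "completely_metrizable_space (top_of_set ?\<Omega>)" by simp
  obtain X0 where "X0 \<in> B" using B(2) by blast
  then have "(X0, X0, mat 1) \<in> ?\<Omega>" using J G(2) by (simp add: iff invertible_mat_1 matrix_inv_cancel)
  then have "?\<Omega> \<noteq> {}" by blast
  then obtain W where W: "open W" "?\<Omega> \<inter> W \<noteq> {}" "embedded_submanifold k (?\<Omega> \<inter> W)"
    using immersed_submanifold_embedded_somewhere[OF T _ cm] by blast
  then obtain X Y P where p: "(X, Y, P) \<in> ?\<Omega>" "(X, Y, P) \<in> W" by (auto; metis prod.exhaust)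
  have XY: "X \<in> B" "Y \<in> B" and P: "invertible P" using p(1) by (auto simp: iff)
  note JX = J[OF XY(1)] and JY = J[OF XY(2)]
  define g0 where "g0 = ?J Y ** P ** matrix_inv (?J X)"
  have g0: "g0 \<in> G" using p(1) by (simp add: g0_def iff)
  let ?S = "?\<Omega> \<inter> W"
  \<comment> \<open>\<open>?l\<close> turns a chart matrix into the matrix of a jet from
    \<open>X\<close> to \<open>Y\<close>, so \<open>?f\<close> parametrizes that fibre.\<close>
  let ?l = "\<lambda>z :: real^'n^'n. matrix_inv (?J Y) ** z ** ?J X"
  let ?f = "\<lambda>z. (X, Y, ?l z)"
  have bl: "bounded_linear ?l"
    using bounded_linear_compose[OF bounded_bilinear.bounded_linear_left[OF bounded_bilinear_matrix_mult]
        bounded_bilinear.bounded_linear_right[OF bounded_bilinear_matrix_mult]] .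
  have smf: "smooth_on UNIV ?f"
    by (intro smooth_on_Pair smooth_on_const smooth_on_bounded_linear[OF bl] open_UNIV)
  have lg0: "?l g0 = P"
    using JX JY by (simp add: g0_def matrix_mul_assoc matrix_mult_inv_cancel matrix_inv_cancel)
  then have fg0: "?f g0 = (X, Y, P)" by simp
  have derf: "frechet_derivative ?f (at z) = (\<lambda>v. (0, 0, ?l v))" for z
    by (rule frechet_derivative_at[symmetric])
      (intro has_derivative_Pair has_derivative_const bounded_linear_imp_has_derivative bl)
  have trans: "\<exists>v. \<exists>t\<in>tangent_space (top_of_set ?S) (?f g0). w = frechet_derivative ?f (at g0) v + t" for w
  proof -
    obtain a b C where w: "w = (a, b, C)" by (metis prod.exhaust)
    \<comment> \<open>The curve \<open>?c\<close> moves source and target with velocities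
      \<open>a\<close> and \<open>b\<close> while its chart matrix stays \<open>g0\<close>; it
      therefore remains in the groupoid.\<close>
    let ?la = "\<lambda>s::real. X + s *\<^sub>R a" and ?lb = "\<lambda>s::real. Y + s *\<^sub>R b"
    let ?R = "?la -` B \<inter> ?lb -` B"
    let ?c = "\<lambda>s. (?la s, ?lb s, matrix_inv (?J (?lb s)) ** g0 ** ?J (?la s))"
    have R: "open ?R"
      by (intro open_Int open_vimage B(1) continuous_intros)
    have lin: "smooth_on ?R (\<lambda>s. x + s *\<^sub>R y)" for x y :: "real^'n"
      by (intro smooth_on_add R smooth_on_const smooth_on_linear linearI) (auto simp: algebra_simps)
    have ja: "smooth_on ?R (\<lambda>s. ?J (?la s))"
      by (rule smooth_on_compose[OF R lin smooth_on_jacobian[OF B(1) sm\<kappa>]]) auto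
    have "smooth_on ?R (\<lambda>s. ?J (?lb s))"
      by (rule smooth_on_compose[OF R lin smooth_on_jacobian[OF B(1) sm\<kappa>]]) auto
    then have jb: "smooth_on ?R (\<lambda>s. matrix_inv (?J (?lb s)))"
      by (rule smooth_on_compose[OF R _ smooth_on_matrix_inv]) (auto intro: J)
    have smc: "smooth_on ?R ?c"
      by (intro smooth_on_Pair R lin smooth_on_matrix_mult jb ja smooth_on_const)
    have c0: "?c 0 = (X, Y, P)" using lg0 by simp
    have "open (?R \<inter> ?c -` W)"
      by (rule continuous_open_preimage[OF smooth_on_continuous_on[OF smc] R W(1)])
    moreover have "0 \<in> ?R \<inter> ?c -` W" using XY p(2) c0 by simp
    ultimately obtain e where e: "e > 0" "ball 0 e \<subseteq> ?R \<inter> ?c -` W" by (rule openE)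
    then have sub: "{-e<..<e} \<subseteq> ?R \<inter> ?c -` W" by (simp add: ball_eq_greaterThanLessThan)
    have "?c s \<in> ?S" if "s \<in> {-e<..<e}" for s
    proof -
      have s: "?la s \<in> B" "?lb s \<in> B" "?c s \<in> W" using sub that by auto
      then show ?thesis
        using g0 G(1) J[OF s(1)] J[OF s(2)]
        by (auto simp: iff matrix_mul_assoc matrix_mult_inv_cancel matrix_inv_cancel
            intro!: invertible_mult invertible_matrix_inv)
    qed
    then have cS: "?c ` {-e<..<e} \<subseteq> ?S" by blast
    obtain t where t: "(?c has_vector_derivative t) (at 0)"
      using smooth_on_has_derivative[OF smc, of 0] XY
      by (metis (no_types, lifting) IntI add.right_neutral differentiableI scaleR_zero_left vector_derivative_works vimageI)
    have tS: "t \<in> tangent_space (top_of_set ?S) (?f g0)"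
      using smooth_curve_in_tangent_space[OF e(1) smooth_on_subset[OF smc] cS t] sub unfolding c0 fg0 by blast
    have "((\<lambda>s. fst (?c s)) has_vector_derivative fst t) (at 0)"
      using bounded_linear.has_vector_derivative[OF bounded_linear_fst t] .
    moreover have "((\<lambda>s. fst (?c s)) has_vector_derivative a) (at 0)"
      by (auto intro!: derivative_eq_intros simp: has_vector_derivative_def)
    ultimately have ta: "fst t = a" by (rule vector_derivative_unique_at)
    have "((\<lambda>s. fst (snd (?c s))) has_vector_derivative fst (snd t)) (at 0)"
      using bounded_linear.has_vector_derivative[OF bounded_linear_fst
          bounded_linear.has_vector_derivative[OF bounded_linear_snd t]] .
    moreover have "((\<lambda>s. fst (snd (?c s))) has_vector_derivative b) (at 0)"
      by (auto intro!: derivative_eq_intros simp: has_vector_derivative_def)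
    ultimately have tb: "fst (snd t) = b" by (rule vector_derivative_unique_at)
    \<comment> \<open>After subtracting \<open>t\<close>, only a matrix part of \<open>w\<close> is
      left; it lies in the range of the derivative of \<open>?f\<close>, as \<open>?l\<close> is
      onto.\<close>
    let ?v = "?J Y ** (C - snd (snd t)) ** matrix_inv (?J X)"
    have "?l ?v = C - snd (snd t)"
      using JX JY by (simp add: matrix_mul_assoc matrix_mult_inv_cancel matrix_inv_cancel)
    then have "w = frechet_derivative ?f (at g0) ?v + t"
      using ta tb by (simp add: derf w prod_eq_iff)
    then show ?thesis using tS by blast
  qed
  have fS: "?f g0 \<in> ?S" using p by (simp add: fg0)
  obtain U V and \<Psi> :: "real^'n^'n \<Rightarrow> real^'n^'n" and E where U: "g0 \<in> U" "diffeomorphism U V \<Psi>"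
    and E: "subspace E" "dim E + DIM('n jet) = DIM(real^'n^'n) + k" "\<Psi> ` (U \<inter> ?f -` ?S) = V \<inter> E"
    using embedded_submanifold_transversal_preimage[OF W(3) smf fS trans] by blast
  \<comment> \<open>Over the preimage of \<open>W\<close>, membership of \<open>?f z\<close> in the
    embedded piece is just membership of \<open>z\<close> in \<open>G\<close>.\<close>
  define U1 where "U1 = U \<inter> ?f -` W"
  have "open U1"
    unfolding U1_def using U(2) W(1) smooth_on_continuous_on[OF smf]
    by (intro open_Int open_vimage) (auto simp: diffeomorphism_def)
  then have d1: "diffeomorphism U1 (\<Psi> ` U1) \<Psi>"
    using U(2) by (intro diffeomorphism_restrict[OF U(2)]) (auto simp: U1_def)
  have "U \<inter> ?f -` ?S = U1 \<inter> G"
  proof -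
    have "?f z \<in> ?\<Omega> \<longleftrightarrow> z \<in> G" for z
    proof
      show "z \<in> G" if "?f z \<in> ?\<Omega>"
        using that JX JY by (simp add: iff matrix_mul_assoc matrix_mult_inv_cancel matrix_inv_cancel)
      show "?f z \<in> ?\<Omega>" if "z \<in> G"
        using that JX JY XY G(1)
        by (auto simp: iff matrix_mul_assoc matrix_mult_inv_cancel matrix_inv_cancel
            intro!: invertible_mult invertible_matrix_inv)
    qed
    then show ?thesis by (auto simp: U1_def)
  qed
  then have img: "\<Psi> ` (U1 \<inter> G) = V \<inter> E" using E(3) by simp
  have "\<Psi> ` U1 \<subseteq> V" using U(2) by (auto simp: U1_def diffeomorphism_def bij_betw_def)
  then have "\<Psi> ` (U1 \<inter> G) = \<Psi> ` U1 \<inter> E" using img by blast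
  moreover have "g0 \<in> U1" using U(1) p(2) fg0 by (simp add: U1_def)
  \<comment> \<open>A jet has \<open>2 * CARD('n)\<close> coordinates besides those of its
    matrix.\<close>
  moreover have "dim E + 2 * CARD('n) = k" using E(2) by simp
  ultimately show thesis using g0 d1 E(1) by (intro that[of g0 U1 "\<Psi> ` U1" \<Psi> E])
qed

text \<open>The homogeneous configuration is a single chart for the whole body. In it, curves of
  material isomorphisms have chart matrices in \<open>G\<close>, so their velocities have matrix
  part in its Lie algebra; a dimension count shows that all such vectors occur.\<close>

lemma homogeneous_imp_integrable:
  fixes W :: "3 jet \<Rightarrow> 'v::real_normed_vector"
  assumes body: "body B W" and T: "topspace T = material_groupoid B W" "immersed_submanifold k T"
    and hom: "homogeneous B W"
  shows "\<exists>G :: (real^3^3) topology. lie_subgroup_GL G \<and> integrable_by B (lie_algebroid B T) G"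
proof (cases "B = {}")
  case True
  then show ?thesis using exists_lie_subgroup_GL by (auto simp: integrable_by_def)
next
  case False
  then obtain X0 where X0: "X0 \<in> B" by blast
  have B: "open B" and "W differentiable_on B \<times> B \<times> GL"
    using body by (auto simp: body_def Pi1_eq)
  then have W: "continuous_on (B \<times> B \<times> GL) W" by (intro differentiable_imp_continuous_on)
  obtain \<kappa> where "deformation B \<kappa>"
    and hom': "\<And>X Y. X \<in> B \<Longrightarrow> Y \<in> B \<Longrightarrow>
        jet1 (inv_into B \<kappa> \<circ> translate (\<kappa> Y - \<kappa> X) \<circ> \<kappa>) X \<in> material_groupoid B W"
    using hom unfolding homogeneous_def by blast
  then have d: "diffeomorphism B (\<kappa> ` B) \<kappa>" using deformation_iff_diffeomorphism[OF B] by blast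
  let ?J = "jacobian \<kappa>"
  have hom'': "(X, Y, matrix_inv (?J Y) ** ?J X) \<in> material_groupoid B W" if "X \<in> B" "Y \<in> B" for X Y
    using hom'[OF that] jet1_translation_conjugate[OF d that] by simp
  obtain G where G: "G \<subseteq> GL" "mat 1 \<in> G" "\<And>A. A \<in> G \<Longrightarrow> matrix_inv A \<in> G"
    "\<And>A C. A \<in> G \<Longrightarrow> C \<in> G \<Longrightarrow> A ** C \<in> G" "closedin (top_of_set GL) G"
    and iff: "\<And>X Y P. (X, Y, P) \<in> material_groupoid B W \<longleftrightarrow>
      X \<in> B \<and> Y \<in> B \<and> invertible P \<and> ?J Y ** P ** matrix_inv (?J X) \<in> G"
    by (rule homogeneous_material_groupoid[OF B X0 W d hom'']) blast+
  obtain g0 U V and \<Psi> :: "real^3^3 \<Rightarrow> real^3^3" and E where ch: "g0 \<in> G" "g0 \<in> U" "diffeomorphism U V \<Psi>"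
    "subspace E" "dim E + 2 * CARD(3) = k" "\<Psi> ` (U \<inter> G) = V \<inter> E"
    by (rule isotropy_group_chart[OF B False d G(1,2,5) iff[folded T(1)] T(2)])
  have emb: "embedded_submanifold (dim E) G" and lie: "lie_subgroup_GL (top_of_set G)"
    using lie_subgroup_GL_of_chart[OF G(1-4) ch(1-4) refl ch(6)] by auto
  let ?g = "tangent_space (top_of_set G) (mat 1)"
  have g: "subspace ?g" "dim ?g = dim E"
    using tangent_space_immersed_submanifold[OF embedded_submanifold_imp_immersed[OF emb]] G(2) by auto
  have image: "frechet_derivative (jet_coords \<kappa>) (at (jid X)) ` tangent_space T (jid X) = UNIV \<times> UNIV \<times> ?g"
    if X: "X \<in> B" for X
  proof (rule subspace_dim_equal)
    let ?D = "frechet_derivative (jet_coords \<kappa>) (at (jid X))"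
    have D: "(jet_coords \<kappa> has_derivative ?D) (at (jid X))" "inj ?D"
      using jet_coords_derivative[OF d X] by auto
    note linD = has_derivative_linear[OF D(1)]
    have JX: "invertible (?J X)" using d X by (rule invertible_jacobian)
    have "jid X \<in> topspace T"
      using X JX G(2) by (simp add: T(1) iff jid_eq invertible_mat_1 matrix_inv_cancel)
    note TT = tangent_space_immersed_submanifold[OF T(2) this]
    show "subspace (?D ` tangent_space T (jid X))"
      using linD TT(1) by (rule linear_subspace_image)
    show sub: "subspace ((UNIV :: (real^3) set) \<times> (UNIV :: (real^3) set) \<times> ?g)"
      using g(1) by (intro subspace_Times) auto
    show "?D ` tangent_space T (jid X) \<subseteq> UNIV \<times> UNIV \<times> ?g"
    proof
      fix y assume "y \<in> ?D ` tangent_space T (jid X)"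
      then obtain w where w: "w \<in> tangent_space T (jid X)" and y: "y = ?D w" by blast
      obtain e \<gamma> where e: "e > 0" "smooth_map (top_of_set {-e<..<e}) T \<gamma>" "\<gamma> 0 = jid X"
        and \<gamma>': "(\<gamma> has_vector_derivative w) (at 0)"
        using w by (auto simp: tangent_space_def)
      obtain \<delta> where \<delta>: "\<delta> > 0" "smooth_on {-\<delta><..<\<delta>} \<gamma>" "\<gamma> ` {-\<delta><..<\<delta>} \<subseteq> material_groupoid B W"
        using smooth_curve_imp_smooth_on[OF e(2,1)] T(1) by metis
      let ?c = "\<lambda>t. snd (snd (jet_coords \<kappa> (\<gamma> t)))"
      have q: "j \<in> B \<times> B \<times> GL \<and> snd (snd (jet_coords \<kappa> j)) \<in> G" if "j \<in> material_groupoid B W" for j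
        using that by (cases j) (auto simp: iff jet_coords_eq)
      have "smooth_on {-\<delta><..<\<delta>} (\<lambda>t. jet_coords \<kappa> (\<gamma> t))"
        by (rule smooth_on_compose[OF _ \<delta>(2) smooth_on_jet_coords[OF d]]) (use \<delta>(3) q in auto)
      then have smc: "smooth_on {-\<delta><..<\<delta>} ?c"
        by (rule smooth_on_bounded_linear_comp[OF bounded_linear_compose[OF bounded_linear_snd bounded_linear_snd], rotated]) simp
      have "((\<lambda>t. jet_coords \<kappa> (\<gamma> t)) has_vector_derivative ?D w) (at 0)"
        by (rule has_vector_derivative_compose_at[OF \<gamma>']) (simp add: e(3) D(1))
      then have "(?c has_vector_derivative snd (snd y)) (at 0)"
        unfolding y by (intro bounded_linear.has_vector_derivative[OF bounded_linear_snd])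
      moreover have "?c ` {-\<delta><..<\<delta>} \<subseteq> G" using \<delta>(3) q by blast
      ultimately have "snd (snd y) \<in> tangent_space (top_of_set G) (?c 0)"
        using smooth_curve_in_tangent_space[OF \<delta>(1) smc] by metis
      moreover have "?c 0 = mat 1"
        using JX by (simp add: e(3) jid_eq jet_coords_eq matrix_inv_cancel)
      ultimately show "y \<in> UNIV \<times> UNIV \<times> ?g" by (simp add: mem_Times_iff)
    qed
    have "dim (?D ` tangent_space T (jid X)) = k"
      using dim_image_eq[OF linD, of "tangent_space T (jid X)"] D(2) TT(2) by (auto intro: inj_on_subset)
    \<comment> \<open>Two copies of three-space and a Lie algebra of dimension
      \<open>k - 6\<close>.\<close>
    moreover have "dim ((UNIV :: (real^3) set) \<times> (UNIV :: (real^3) set) \<times> ?g) = k"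
      using ch(5) g by (simp add: dim_Times subspace_Times)
    ultimately show "dim ((UNIV :: (real^3) set) \<times> (UNIV :: (real^3) set) \<times> ?g)
        \<le> dim (?D ` tangent_space T (jid X))" by simp
  qed
  have "algebroid_coords \<kappa> ` {a \<in> lie_algebroid B T. fst a \<in> B} = \<kappa> ` B \<times> UNIV \<times> ?g" (is "?l = ?r")
  proof
    show "?l \<subseteq> ?r"
    proof
      fix c assume "c \<in> ?l"
      then obtain X w where c: "c = algebroid_coords \<kappa> (X, w)" and X: "X \<in> B" "w \<in> tangent_space T (jid X)"
        by (auto simp: lie_algebroid_def)
      let ?D = "frechet_derivative (jet_coords \<kappa>) (at (jid X))"
      have "?D w \<in> UNIV \<times> UNIV \<times> ?g" using image[OF X(1)] X(2) by blast
      then show "c \<in> ?r"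
        using X(1) by (simp add: c algebroid_coords_def Let_def jlin_def mem_Times_iff)
    qed
    show "?r \<subseteq> ?l"
    proof clarify
      fix X v A assume X: "X \<in> B" and A: "A \<in> ?g"
      let ?D = "frechet_derivative (jet_coords \<kappa>) (at (jid X))"
      \<comment> \<open>The target component is chosen to be 0; injectivity of the derivative of
        \<open>\<kappa>\<close> then puts \<open>w\<close> into the kernel of the target map, which
        is the algebroid fibre.\<close>
      have "(v, 0, A) \<in> ?D ` tangent_space T (jid X)" unfolding image[OF X] using A by simp
      then obtain w where Dw: "(v, 0, A) = ?D w" and w: "w \<in> tangent_space T (jid X)" by (rule imageE)
      have "frechet_derivative \<kappa> (at X) (jtgt w) = 0"
        using jet_coords_derivative(3)[OF d X, of w] Dw[symmetric] by (simp add: jtgt_def)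
      then have "jtgt w = 0"
        using diffeomorphism_derivative(2,3)[OF d X] linear_injective_0 by blast
      then have mem: "(X, w) \<in> {a \<in> lie_algebroid B T. fst a \<in> B}"
        using X w by (simp add: lie_algebroid_def frechet_derivative_jtgt)
      have "(\<kappa> X, v, A) = algebroid_coords \<kappa> (X, w)"
        by (simp add: algebroid_coords_def Dw[symmetric] jsrc_def jlin_def)
      then show "(\<kappa> X, v, A) \<in> ?l" using mem by (rule image_eqI)
    qed
  qed
  then have "integrable_by B (lie_algebroid B T) (top_of_set G)"
    unfolding integrable_by_def lie_algebra_of_def using d by (auto simp: chart_on_def)
  with lie show ?thesis by blast
qed

theorem proposition5p3:
  fixes B :: "(real^3) set"
    and W :: "3 jet \<Rightarrow> 'v::real_normed_vector"
    and T :: "3 jet topology"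
  assumes "body B W"
    and "uniform_body B W"
    and "topspace T = material_groupoid B W"
    and "lie_subgroupoid B T"
  shows "(homogeneous B W \<longrightarrow>
            (\<exists>G :: (real^3^3) topology. lie_subgroup_GL G \<and> integrable_by B (lie_algebroid B T) G)) \<and>
         ((\<exists>G :: (real^3^3) topology. lie_subgroup_GL G \<and> integrable_by B (lie_algebroid B T) G) \<longrightarrow>
            locally_homogeneous B W)"
proof (intro conjI impI)
  obtain k where "immersed_submanifold k T"
    using assms(4) unfolding lie_subgroupoid_def by blast
  then show "\<exists>G :: (real^3^3) topology. lie_subgroup_GL G \<and> integrable_by B (lie_algebroid B T) G"
    if "homogeneous B W"
    using homogeneous_imp_integrable assms(1,3) that by blast
  show "locally_homogeneous B W"
    if "\<exists>G :: (real^3^3) topology. lie_subgroup_GL G \<and> integrable_by B (lie_algebroid B T) G"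
    using integrable_imp_locally_homogeneous assms(1,3) that by blast
qed

end
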